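(* The $M_{(I,u)}$, where $(I,u)$ runs over colored compositions, span a subalgebra of $\mathbb{C}[\mathbb{X}]$ which can be identified with the graded dual of $\mathbf{MR}^{(\ell)}$ through the pairing $$\langle M_{(I,u)},S^{(J,v)}\rangle=\delta_{I,J}\,\delta_{u,v},$$ where $\delta$ is the Kronecker symbol.
   Context: A colored composition is a pair $(I,u)=((i_1,\ldots,i_m),(u_1,\ldots,u_m))$ formed by a composition $I$ (a sequence of positive integers) and a color vector $u$ of the same length, with $u_1,\ldots,u_m\in\{0,\ldots,\ell-1\}$. The Hopf algebra $\mathbf{MR}^{(\ell)}$ (Mantaci-Reutenauer algebra of level $\ell$) is the free associative algebra on generators $S_n^{(i)}$ of degree $n$ ($n\ge 1$, $0\le i\le\ell-1$), with coproduct $\Delta S_n^{(i)}=\sum_{p+q=n}S_p^{(i)}\otimes S_q^{(i)}$ (where $S_0^{(i)}=1$). It has the linear basis $S^{(I,u)}=S_{i_1}^{(u_1)}\cdots S_{i_m}^{(u_m)}$ indexed by colored compositions. Let $\mathbb{X}=\{x_j^{(c)}: j\ge 1,\ 0\le c\le\ell-1\}$ be an infinite set of commuting variables, and let $\mathbb{C}[\mathbb{X}]$ denote the algebra of polynomials in these variables, infinite sums of monomials of bounded degree being allowed. The monochromatic monomial quasi-symmetric functions are $$M_{(I,u)}=M_{(I,u)}(\mathbb{X})=\sum_{j_1<\cdots<j_m}(x_{j_1}^{(u_1)})^{i_1}\cdots(x_{j_m}^{(u_m)})^{i_m}.$$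
   Formalization: For ℓ ≥ 2 the span is not closed under products in C[X] (M_((1),(0))·M_((1),(1)) contains x_1^(0)x_1^(1)), so the M_(I,u) are taken in the quotient of C[X] by the relations x_j^(p)x_j^(q)=0 for p≠q; for ℓ ≤ 1 nothing changes. *)

theory Defs
  imports Complex_Main "HOL-Library.Poly_Mapping" "HOL-Library.Product_Plus" "HOL-Library.FuncSet"
begin

section \<open>Colored compositions\<close>

type_synonym colored_comp = "nat list \<times> nat list"

definition colored_compositions :: "nat \<Rightarrow> colored_comp set" where
  "colored_compositions l =
     {(I, u). length I = length u \<and> (\<forall>i\<in>set I. 1 \<le> i) \<and> (\<forall>c\<in>set u. c < l)}"

section \<open>Formal series in colored variables\<close>

text \<open>The variable \<open>x\<^sub>j\<^sup>(\<^sup>c\<^sup>)\<close> is encoded by the pair \<open>(j, c)\<close>, a monomial by its exponents.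
  All formal series in these variables form the type \<open>pseries\<close>; the algebra \<open>\<complex>[\<bbbX>]\<close>
  of those of bounded degree is the subset \<open>bounded_series\<close> below.\<close>

type_synonym monomial = "(nat \<times> nat) \<Rightarrow>\<^sub>0 nat"

typedef pseries = "UNIV :: (monomial \<Rightarrow> complex) set"
  morphisms coeff Pseries ..

lemma coeff_Pseries [simp]: "coeff (Pseries f) = f"
  by (simp add: Pseries_inverse)

lemma pseries_eqI: "(\<And>m. coeff f m = coeff g m) \<Longrightarrow> f = g"
  by (metis coeff_inject ext)

lemma finite_decompositions: "finite {(a, b). a + b = (m :: monomial)}"
proof -
  let ?F = "{f. \<forall>x. (x \<in> Poly_Mapping.keys m \<longrightarrow> f x \<in> {..Max (range (Poly_Mapping.lookup m))}) \<and>
                    (x \<notin> Poly_Mapping.keys m \<longrightarrow> f x = (0::nat))}"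
  have fin_range: "finite (range (Poly_Mapping.lookup m))"
  proof (rule finite_subset)
    show "range (Poly_Mapping.lookup m) \<subseteq> insert 0 (Poly_Mapping.lookup m ` Poly_Mapping.keys m)"
      by (auto simp: in_keys_iff)
  qed simp
  have "finite ?F"
    by (rule finite_set_of_finite_funs) auto
  moreover have "Poly_Mapping.lookup ` {a. \<exists>b. a + b = m} \<subseteq> ?F"
  proof safe
    fix a b x assume m: "m = a + b"
    have le: "Poly_Mapping.lookup a x \<le> Poly_Mapping.lookup (a + b) x" by (simp add: lookup_add)
    show "Poly_Mapping.lookup a x \<le> Max (range (Poly_Mapping.lookup (a + b)))"
      using le fin_range m by (meson Max_ge order_trans rangeI)
    assume "x \<notin> Poly_Mapping.keys (a + b)"
    with le show "Poly_Mapping.lookup a x = 0" by (simp add: in_keys_iff)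
  qed
  ultimately have "finite (Poly_Mapping.lookup ` {a. \<exists>b. a + b = m})"
    by (rule rev_finite_subset)
  hence "finite {a. \<exists>b. a + b = m}"
    by (rule finite_imageD) (simp add: inj_on_def)
  moreover have "{(a, b). a + b = m} \<subseteq> (\<lambda>a. (a, m - a)) ` {a. \<exists>b. a + b = m}"
    by auto
  ultimately show ?thesis
    by (meson finite_imageI finite_subset)
qed

instantiation pseries :: comm_ring_1
begin

definition "0 = Pseries (\<lambda>m. 0)"
definition "1 = Pseries (\<lambda>m. if m = 0 then 1 else 0)"
definition "f + g = Pseries (\<lambda>m. coeff f m + coeff g m)"
definition "- f = Pseries (\<lambda>m. - coeff f m)"
definition "f - g = Pseries (\<lambda>m. coeff f m - coeff g m)"
definition "f * g = Pseries (\<lambda>m. \<Sum>(a, b) \<in> {(a, b). a + b = m}. coeff f a * coeff g b)"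

instance
proof
  fix f g h :: pseries
  show "f * g = g * f"
  proof (rule pseries_eqI)
    fix m
    show "coeff (f * g) m = coeff (g * f) m"
      unfolding times_pseries_def coeff_Pseries
      by (rule sum.reindex_bij_witness[where i = prod.swap and j = prod.swap])
         (auto simp: add.commute mult.commute)
  qed
  show "f * g * h = f * (g * h)"
  proof (rule pseries_eqI)
    fix m
    have "coeff (f * g * h) m = (\<Sum>p \<in> {(d, c). d + c = m}. \<Sum>q \<in> {(a, b). a + b = fst p}.
            coeff f (fst q) * coeff g (snd q) * coeff h (snd p))"
      by (simp add: times_pseries_def case_prod_beta' sum_distrib_right)
    also have "\<dots> = (\<Sum>(p, q) \<in> Sigma {(d, c). d + c = m} (\<lambda>p. {(a, b). a + b = fst p}).
            coeff f (fst q) * coeff g (snd q) * coeff h (snd p))"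
      by (rule sum.Sigma) (auto intro: finite_decompositions)
    also have "\<dots> = (\<Sum>(p, q) \<in> Sigma {(a, d). a + d = m} (\<lambda>p. {(b, c). b + c = snd p}).
            coeff f (fst p) * (coeff g (fst q) * coeff h (snd q)))"
      by (rule sum.reindex_bij_witness
            [where i = "\<lambda>(p, q). ((fst p + fst q, snd q), (fst p, fst q))"
               and j = "\<lambda>(p, q). ((fst q, snd q + snd p), (snd q, snd p))"])
         (auto simp: add.assoc mult.assoc)
    also have "\<dots> = (\<Sum>p \<in> {(a, d). a + d = m}. \<Sum>q \<in> {(b, c). b + c = snd p}.
            coeff f (fst p) * (coeff g (fst q) * coeff h (snd q)))"
      by (rule sum.Sigma[symmetric]) (auto intro: finite_decompositions)
    also have "\<dots> = coeff (f * (g * h)) m"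
      by (simp add: times_pseries_def case_prod_beta' sum_distrib_left)
    finally show "coeff (f * g * h) m = coeff (f * (g * h)) m" .
  qed
  show "1 * f = f"
  proof (rule pseries_eqI)
    fix m
    have "coeff (1 * f) m =
          (\<Sum>p \<in> {(a, b). a + b = m}. if p = (0, m) then coeff f m else 0)"
      unfolding times_pseries_def one_pseries_def coeff_Pseries
      by (rule sum.cong) (auto split: if_splits)
    also have "\<dots> = coeff f m"
      by (simp add: finite_decompositions)
    finally show "coeff (1 * f) m = coeff f m" .
  qed
  show "(f + g) * h = f * h + g * h"
    by (rule pseries_eqI)
       (simp add: times_pseries_def plus_pseries_def case_prod_beta' distrib_right sum.distrib)
  show "(0 :: pseries) \<noteq> 1"
  proof
    assume "(0 :: pseries) = 1"
    hence "coeff 0 0 = coeff 1 0" by simp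
    thus False by (simp add: zero_pseries_def one_pseries_def)
  qed
qed (auto intro!: pseries_eqI
      simp: plus_pseries_def zero_pseries_def uminus_pseries_def minus_pseries_def)

end

definition scale_pseries :: "complex \<Rightarrow> pseries \<Rightarrow> pseries" where
  "scale_pseries c f = Pseries (\<lambda>m. c * coeff f m)"

interpretation pseries: vector_space scale_pseries
  by unfold_locales
     (auto intro!: pseries_eqI simp: scale_pseries_def plus_pseries_def algebra_simps)

definition var :: "nat \<Rightarrow> nat \<Rightarrow> pseries" where
  "var j c = Pseries (\<lambda>m. if m = Poly_Mapping.single (j, c) 1 then 1 else 0)"

definition monomial_degree :: "monomial \<Rightarrow> nat" where
  "monomial_degree m = (\<Sum>v\<in>Poly_Mapping.keys m. Poly_Mapping.lookup m v)"

definition bounded_series :: "nat \<Rightarrow> pseries set" where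
  "bounded_series l =
     {f. \<exists>d. \<forall>m. coeff f m \<noteq> 0 \<longrightarrow>
            monomial_degree m \<le> d \<and> Poly_Mapping.keys m \<subseteq> {(j, c). 1 \<le> j \<and> c < l}}"

definition homogeneous_series :: "nat \<Rightarrow> pseries set" where
  "homogeneous_series n = {f. \<forall>m. coeff f m \<noteq> 0 \<longrightarrow> monomial_degree m = n}"

definition is_subalgebra :: "(complex \<Rightarrow> 'a \<Rightarrow> 'a) \<Rightarrow> 'a::comm_ring_1 set \<Rightarrow> 'a set \<Rightarrow> bool" where
  "is_subalgebra scale A B \<longleftrightarrow>
     A \<subseteq> B \<and> module.subspace scale A \<and> 1 \<in> A \<and> (\<forall>f\<in>A. \<forall>g\<in>A. f * g \<in> A)"

lemma monomial_degree_add: "monomial_degree (a + b) = monomial_degree a + monomial_degree b"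
proof -
  have *: "monomial_degree m = (\<Sum>v\<in>A. Poly_Mapping.lookup m v)"
    if "finite A" "Poly_Mapping.keys m \<subseteq> A" for m A
    unfolding monomial_degree_def
    by (rule sum.mono_neutral_left) (use that in \<open>auto simp: in_keys_iff\<close>)
  have "Poly_Mapping.keys (a + b) \<subseteq> Poly_Mapping.keys a \<union> Poly_Mapping.keys b"
    by (rule keys_add)
  thus ?thesis
    by (simp add: *[of "Poly_Mapping.keys a \<union> Poly_Mapping.keys b"] lookup_add sum.distrib)
qed

lemma bounded_series_subalgebra: "is_subalgebra scale_pseries (bounded_series l) UNIV"
  unfolding is_subalgebra_def
proof (intro conjI ballI)
  show "pseries.subspace (bounded_series l)"
  proof (rule pseries.subspaceI)
    show "0 \<in> bounded_series l"
      by (simp add: bounded_series_def zero_pseries_def)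
    show "scale_pseries c f \<in> bounded_series l" if "f \<in> bounded_series l" for c f
      using that by (auto simp: bounded_series_def scale_pseries_def)
    show "f + g \<in> bounded_series l" if "f \<in> bounded_series l" "g \<in> bounded_series l" for f g
    proof -
      from that(1) obtain d where d: "coeff f m \<noteq> 0 \<Longrightarrow> monomial_degree m \<le> d \<and>
          Poly_Mapping.keys m \<subseteq> {(j, c). 1 \<le> j \<and> c < l}" for m
        unfolding bounded_series_def by blast
      from that(2) obtain e where e: "coeff g m \<noteq> 0 \<Longrightarrow> monomial_degree m \<le> e \<and>
          Poly_Mapping.keys m \<subseteq> {(j, c). 1 \<le> j \<and> c < l}" for m
        unfolding bounded_series_def by blast
      have "monomial_degree m \<le> max d e \<and> Poly_Mapping.keys m \<subseteq> {(j, c). 1 \<le> j \<and> c < l}"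
        if "coeff (f + g) m \<noteq> 0" for m
      proof (cases "coeff f m = 0")
        case True
        with that have "coeff g m \<noteq> 0" by (simp add: plus_pseries_def)
        from e[OF this] show ?thesis by auto
      next
        case False
        from d[OF this] show ?thesis by auto
      qed
      thus ?thesis unfolding bounded_series_def by blast
    qed
  qed
  show "1 \<in> bounded_series l"
    by (auto simp: bounded_series_def one_pseries_def monomial_degree_def)
  show "f * g \<in> bounded_series l" if "f \<in> bounded_series l" "g \<in> bounded_series l" for f g
  proof -
    from that(1) obtain d where d: "coeff f m \<noteq> 0 \<Longrightarrow> monomial_degree m \<le> d \<and>
        Poly_Mapping.keys m \<subseteq> {(j, c). 1 \<le> j \<and> c < l}" for m
      unfolding bounded_series_def by blast
    from that(2) obtain e where e: "coeff g m \<noteq> 0 \<Longrightarrow> monomial_degree m \<le> e \<and>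
        Poly_Mapping.keys m \<subseteq> {(j, c). 1 \<le> j \<and> c < l}" for m
      unfolding bounded_series_def by blast
    have "monomial_degree m \<le> d + e \<and> Poly_Mapping.keys m \<subseteq> {(j, c). 1 \<le> j \<and> c < l}"
      if "coeff (f * g) m \<noteq> 0" for m
    proof -
      from that obtain a b where "a + b = m" "coeff f a \<noteq> 0" "coeff g b \<noteq> 0"
        unfolding times_pseries_def coeff_Pseries
        by (elim sum.not_neutral_contains_not_neutral) auto
      with d[of a] e[of b] keys_add[of a b] show ?thesis
        by (auto simp: monomial_degree_add)
    qed
    thus ?thesis unfolding bounded_series_def by blast
  qed
qed simp_all

text \<open>A possibly infinite formal sum: each coefficient is the sum of the nonzero contributions,
  and it is meaningful when every monomial receives only finitely many of these.\<close>

definition formal_sum :: "('i \<Rightarrow> pseries) \<Rightarrow> 'i set \<Rightarrow> pseries" where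
  "formal_sum F A = Pseries (\<lambda>m. \<Sum>i \<in> {i \<in> A. coeff (F i) m \<noteq> 0}. coeff (F i) m)"

definition M_qsym :: "colored_comp \<Rightarrow> pseries" where
  "M_qsym = (\<lambda>(I, u). formal_sum (\<lambda>js. \<Prod>k<length I. var (js ! k) (u ! k) ^ (I ! k))
          {js. length js = length I \<and> (\<forall>j\<in>set js. 1 \<le> j) \<and> sorted_wrt (<) js})"

section \<open>The relations \<open>x\<^sub>j\<^sup>(\<^sup>p\<^sup>) x\<^sub>j\<^sup>(\<^sup>q\<^sup>) = 0\<close>\<close>

definition mono_series :: "monomial \<Rightarrow> pseries" where
  "mono_series a = Pseries (\<lambda>m. if m = a then 1 else 0)"

lemma mono_series_mult: "mono_series a * mono_series b = mono_series (a + b)"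
proof (rule pseries_eqI)
  fix m
  have "coeff (mono_series a * mono_series b) m =
        (\<Sum>p \<in> {(c, d). c + d = m}. if p = (a, b) then 1 else 0)"
    unfolding times_pseries_def mono_series_def coeff_Pseries
    by (rule sum.cong) (auto split: if_splits)
  also have "\<dots> = coeff (mono_series (a + b)) m"
    by (auto simp: finite_decompositions mono_series_def)
  finally show "coeff (mono_series a * mono_series b) m = coeff (mono_series (a + b)) m" .
qed

lemma mono_series_0: "mono_series 0 = 1"
  by (simp add: mono_series_def one_pseries_def)

lemma var_power: "var j c ^ k = mono_series (Poly_Mapping.single (j, c) k)"
proof (induction k)
  case (Suc k)
  have "var j c = mono_series (Poly_Mapping.single (j, c) 1)"
    by (simp add: var_def mono_series_def)
  thus ?case using Suc by (simp add: mono_series_mult flip: single_add)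
qed (simp add: mono_series_0)

lemma prod_mono_series: "finite A \<Longrightarrow> (\<Prod>k\<in>A. mono_series (a k)) = mono_series (\<Sum>k\<in>A. a k)"
  by (induction A rule: finite_induct) (simp_all add: mono_series_0 mono_series_mult)

text \<open>The relations are needed: for two or more colors the span of the \<open>M_qsym (I, u)\<close> is not
  closed under the multiplication of \<open>\<complex>[\<bbbX>]\<close>, because the product of
  \<open>M_qsym ([1], [0])\<close> and \<open>M_qsym ([1], [1])\<close> contains \<open>x\<^sub>1\<^sup>(\<^sup>0\<^sup>) x\<^sub>1\<^sup>(\<^sup>1\<^sup>)\<close>.\<close>

lemma M_qsym_span_not_subalgebra:
  assumes "2 \<le> l"
  shows "\<not> is_subalgebra scale_pseries (pseries.span (M_qsym ` colored_compositions l)) B"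
proof
  let ?a = "Poly_Mapping.single (1, 0) 1 :: monomial"
  let ?b = "Poly_Mapping.single (1, 1) 1 :: monomial"
  let ?V = "pseries.span (M_qsym ` colored_compositions l)"
  assume sub: "is_subalgebra scale_pseries ?V B"
  have coeff_M: "coeff (M_qsym (I, u)) (?a + ?b) = 0" for I u
  proof -
    have "coeff (\<Prod>k<length I. var (js ! k) (u ! k) ^ (I ! k)) (?a + ?b) = 0"
      if js: "length js = length I" "sorted_wrt (<) js" for js
    proof (rule ccontr)
      let ?m = "\<Sum>k<length I. Poly_Mapping.single (js ! k, u ! k) (I ! k)"
      assume "coeff (\<Prod>k<length I. var (js ! k) (u ! k) ^ (I ! k)) (?a + ?b) \<noteq> 0"
      hence m: "?a + ?b = ?m"
        unfolding var_power prod_mono_series[OF finite_lessThan]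
        by (simp add: mono_series_def split: if_splits)
      have key: "\<exists>k<length I. js ! k = j \<and> u ! k = c"
        if "Poly_Mapping.lookup (?a + ?b) (j, c) \<noteq> 0" for j c
      proof (rule ccontr)
        assume "\<not> ?thesis"
        hence "Poly_Mapping.lookup ?m (j, c) = 0"
          by (auto simp: lookup_sum lookup_single when_def)
        with that m show False by simp
      qed
      from key[of 1 0] obtain k where k: "k < length I" "js ! k = 1" "u ! k = 0"
        by (auto simp: lookup_add lookup_single)
      from key[of 1 1] obtain k' where k': "k' < length I" "js ! k' = 1" "u ! k' = 1"
        by (auto simp: lookup_add lookup_single)
      have "k = k'"
        using sorted_wrt_nth_less[OF js(2)] k k' js(1)
        by (metis linorder_neqE_nat order_less_irrefl)
      with k k' show False by simp
    qed
    thus ?thesis by (auto simp: M_qsym_def formal_sum_def intro!: sum.neutral)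
  qed
  have span: "coeff f (?a + ?b) = 0" if "f \<in> ?V" for f
    using that
  proof (induction rule: pseries.span_induct)
    case base
    show ?case
      by (rule pseries.subspaceI) (auto simp: zero_pseries_def plus_pseries_def scale_pseries_def)
  next
    case (step f)
    thus ?case using coeff_M by auto
  qed
  have coeff_M1: "coeff (M_qsym ([1], [c])) m = (if \<exists>j\<ge>1. m = Poly_Mapping.single (j, c) 1 then 1 else 0)"
    for c m
  proof -
    have js: "length js = Suc 0 \<longleftrightarrow> (\<exists>j. js = [j])" for js :: "nat list"
      by (cases js) auto
    let ?A = "{js. length js = Suc 0 \<and> (\<forall>j\<in>set js. Suc 0 \<le> j) \<and> sorted_wrt (<) js}"
    have "coeff (M_qsym ([1], [c])) m =
      (\<Sum>js\<in>{js\<in>?A. m = Poly_Mapping.single (js ! 0, c) 1}. 1)"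
    proof -
      have "coeff (\<Prod>k<length [1::nat]. var (js ! k) ([c] ! k) ^ ([1] ! k)) m =
          (if m = Poly_Mapping.single (js ! 0, c) 1 then 1 else 0)" for js
        by (simp add: var_def)
      hence "coeff (M_qsym ([1], [c])) m =
          (\<Sum>js\<in>{js\<in>?A. (if m = Poly_Mapping.single (js ! 0, c) 1 then 1 else 0) \<noteq> (0::complex)}.
             if m = Poly_Mapping.single (js ! 0, c) 1 then 1 else 0)"
        unfolding M_qsym_def formal_sum_def by (simp only: prod.case coeff_Pseries) simp
      also have "\<dots> = (\<Sum>js\<in>{js\<in>?A. m = Poly_Mapping.single (js ! 0, c) 1}. 1)"
        by (rule sum.cong) (auto split: if_splits)
      finally show ?thesis .
    qed
    also have "{js\<in>?A. m = Poly_Mapping.single (js ! 0, c) 1} =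
      (\<lambda>j. [j]) ` {j. 1 \<le> j \<and> m = Poly_Mapping.single (j, c) 1}"
      by (auto simp: js)
    also have "(\<Sum>js\<in>\<dots>. 1) = (\<Sum>j\<in>{j. 1 \<le> j \<and> m = Poly_Mapping.single (j, c) 1}. 1 :: complex)"
      by (subst sum.reindex) (auto simp: inj_on_def)
    also have "\<dots> = (if \<exists>j\<ge>1. m = Poly_Mapping.single (j, c) 1 then 1 else 0)"
    proof (cases "\<exists>j\<ge>1. m = Poly_Mapping.single (j, c) 1")
      case True
      then obtain j where "j \<ge> 1" "m = Poly_Mapping.single (j, c) 1" by blast
      hence "{j. 1 \<le> j \<and> m = Poly_Mapping.single (j, c) 1} = {j}"
        by (auto simp: poly_mapping_eq_iff lookup_single fun_eq_iff when_def split: if_splits)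
      thus ?thesis using True by simp
    next
      case False
      hence "{j. 1 \<le> j \<and> m = Poly_Mapping.single (j, c) 1} = {}" by blast
      thus ?thesis using False by (simp only: if_False sum.empty)
    qed
    finally show ?thesis .
  qed
  have "coeff (M_qsym ([1], [0]) * M_qsym ([1], [1])) (?a + ?b) =
    (\<Sum>p\<in>{(c, d). c + d = ?a + ?b}. if p = (?a, ?b) then 1 else 0)"
    unfolding times_pseries_def coeff_Pseries
  proof (rule sum.cong, goal_cases)
    case (2 p)
    obtain c d where p: "p = (c, d)" by force
    have sum: "c + d = ?a + ?b" using 2 p by simp
    show ?case
    proof (cases "p = (?a, ?b)")
      case False
      have "\<not> ((\<exists>j\<ge>1. c = Poly_Mapping.single (j, 0) 1) \<and> (\<exists>j\<ge>1. d = Poly_Mapping.single (j, 1) 1))"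
      proof safe
        fix j j' assume c: "c = Poly_Mapping.single (j, 0) 1" and d: "d = Poly_Mapping.single (j', 1) 1"
        have "Poly_Mapping.lookup (c + d) (1, 0) = 1" "Poly_Mapping.lookup (c + d) (1, 1) = 1"
          unfolding sum by (auto simp: lookup_add lookup_single)
        hence "j = 1" "j' = 1"
          by (auto simp: c d lookup_add lookup_single when_def split: if_splits)
        thus False using c d p False by simp
      qed
      thus ?thesis using False by (auto simp: p coeff_M1[simplified])
    qed (auto simp: p coeff_M1[simplified])
  qed simp
  also have "\<dots> = 1" by (simp add: finite_decompositions)
  finally have "coeff (M_qsym ([1], [0]) * M_qsym ([1], [1])) (?a + ?b) = 1" .
  moreover have "M_qsym ([1], [0]) \<in> ?V" "M_qsym ([1], [1]) \<in> ?V"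
    using assms by (auto intro!: pseries.span_base imageI simp: colored_compositions_def)
  ultimately show False
    using sub span[of "M_qsym ([1], [0]) * M_qsym ([1], [1])"] by (auto simp: is_subalgebra_def)
qed

text \<open>We therefore pass to the quotient of \<open>\<complex>[\<bbbX>]\<close> in which two variables with the same
  index and different colors multiply to zero, as the product dual to the coproduct of the
  Mantaci--Reutenauer algebra requires. \<open>mixed_ideal\<close> is the closed ideal generated by the products \<open>x\<^sub>j\<^sup>(\<^sup>p\<^sup>) x\<^sub>j\<^sup>(\<^sup>q\<^sup>)\<close> with \<open>p \<noteq> q\<close>:
  the series all of whose monomials are divisible by such a product.\<close>

definition mixed_ideal :: "pseries set" where
  "mixed_ideal = {f. \<forall>m. coeff f m \<noteq> 0 \<longrightarrow>
     (\<exists>j p q. p \<noteq> q \<and> (j, p) \<in> Poly_Mapping.keys m \<and> (j, q) \<in> Poly_Mapping.keys m)}"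

lemma mixed_ideal_add: "f \<in> mixed_ideal \<Longrightarrow> g \<in> mixed_ideal \<Longrightarrow> f + g \<in> mixed_ideal"
  unfolding mixed_ideal_def plus_pseries_def by simp (metis add_0)

lemma mixed_ideal_scale: "f \<in> mixed_ideal \<Longrightarrow> scale_pseries c f \<in> mixed_ideal"
  by (simp add: mixed_ideal_def scale_pseries_def)

lemma mixed_ideal_uminus: "f \<in> mixed_ideal \<Longrightarrow> - f \<in> mixed_ideal"
  by (simp add: mixed_ideal_def uminus_pseries_def)

lemma mixed_ideal_mult: "f \<in> mixed_ideal \<Longrightarrow> f * g \<in> mixed_ideal"
  unfolding mixed_ideal_def
proof (safe, goal_cases)
  case (1 m)
  from 1(2) obtain a b where ab: "a + b = m" "coeff f a \<noteq> 0"
    unfolding times_pseries_def coeff_Pseries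
    by (elim sum.not_neutral_contains_not_neutral) auto
  have "Poly_Mapping.keys a \<subseteq> Poly_Mapping.keys m"
    using ab(1) by (auto simp: in_keys_iff lookup_add)
  with 1(1) ab(2) show ?case by blast
qed

quotient_type mseries = pseries / "\<lambda>f g. f - g \<in> mixed_ideal"
  morphisms rep_mseries residue_class
proof (rule equivpI)
  show "reflp (\<lambda>f g. f - g \<in> mixed_ideal)"
    by (rule reflpI) (simp add: mixed_ideal_def zero_pseries_def)
  show "symp (\<lambda>f g. f - g \<in> mixed_ideal)"
    by (rule sympI) (metis mixed_ideal_uminus minus_diff_eq)
  show "transp (\<lambda>f g. f - g \<in> mixed_ideal)"
  proof (rule transpI)
    fix f g h assume "f - g \<in> mixed_ideal" "g - h \<in> mixed_ideal"
    from mixed_ideal_add[OF this] show "f - h \<in> mixed_ideal" by simp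
  qed
qed

instantiation mseries :: comm_ring_1
begin

lift_definition zero_mseries :: mseries is 0 .
lift_definition one_mseries :: mseries is 1 .
lift_definition plus_mseries :: "mseries \<Rightarrow> mseries \<Rightarrow> mseries" is "(+)"
  by (metis add_diff_add mixed_ideal_add)
lift_definition uminus_mseries :: "mseries \<Rightarrow> mseries" is uminus
  by (metis minus_diff_minus mixed_ideal_uminus)
lift_definition minus_mseries :: "mseries \<Rightarrow> mseries \<Rightarrow> mseries" is "(-)"
proof -
  fix f f' g g' assume "f - f' \<in> mixed_ideal" "g - g' \<in> mixed_ideal"
  hence "(f - f') + - (g - g') \<in> mixed_ideal"
    by (intro mixed_ideal_add mixed_ideal_uminus)
  thus "f - g - (f' - g') \<in> mixed_ideal" by (simp add: algebra_simps)
qed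
lift_definition times_mseries :: "mseries \<Rightarrow> mseries \<Rightarrow> mseries" is "(*)"
proof -
  fix f f' g g' assume "f - f' \<in> mixed_ideal" "g - g' \<in> mixed_ideal"
  hence "(f - f') * g + (g - g') * f' \<in> mixed_ideal"
    by (intro mixed_ideal_add mixed_ideal_mult)
  thus "f * g - f' * g' \<in> mixed_ideal" by (simp add: algebra_simps)
qed

instance
proof
  show "(0 :: mseries) \<noteq> 1"
  proof (transfer, rule notI)
    assume "0 - 1 \<in> mixed_ideal"
    moreover have "coeff (0 - 1) 0 \<noteq> 0"
      by (simp add: minus_pseries_def zero_pseries_def one_pseries_def)
    ultimately have "\<exists>j p q. p \<noteq> q \<and> (j, p) \<in> Poly_Mapping.keys (0 :: monomial) \<and>
        (j, q) \<in> Poly_Mapping.keys (0 :: monomial)"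
      unfolding mixed_ideal_def by blast
    thus False by simp
  qed
qed (transfer; simp add: algebra_simps mixed_ideal_def zero_pseries_def; fail)+

end

lift_definition scale_mseries :: "complex \<Rightarrow> mseries \<Rightarrow> mseries" is scale_pseries
  by (metis mixed_ideal_scale pseries.scale_right_diff_distrib)

interpretation mseries: vector_space scale_mseries
  by unfold_locales (transfer; simp add: pseries.scale_right_distrib pseries.scale_left_distrib
       mixed_ideal_def zero_pseries_def; fail)+

definition M_span :: "nat \<Rightarrow> mseries set" where
  "M_span l = mseries.span ((\<lambda>Iu. residue_class (M_qsym Iu)) ` colored_compositions l)"

section \<open>The Mantaci--Reutenauer algebra\<close>

text \<open>The free monoid, written additively because \<open>Poly_Mapping\<close> makes
  \<open>'m \<Rightarrow>\<^sub>0 complex\<close> the monoid algebra of an additive monoid \<open>'m\<close>.\<close>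

datatype 'a word = Word (letters: "'a list")

instantiation word :: (type) monoid_add
begin
definition "0 = Word []"
definition "v + w = Word (letters v @ letters w)"
instance
  by standard (auto simp: zero_word_def plus_word_def)
end

text \<open>The letter \<open>(n, i)\<close> with \<open>n \<ge> 1\<close> and \<open>i < l\<close> stands for the generator \<open>S\<^sub>n\<^sup>(\<^sup>i\<^sup>)\<close>.
  With \<open>Product_Plus\<close>, \<open>mr_tensor\<close> is the monoid algebra of pairs of words, that is, the
  tensor square with multiplication \<open>(a \<otimes> b)(c \<otimes> d) = ac \<otimes> bd\<close>.\<close>

type_synonym mr_word = "(nat \<times> nat) word"
type_synonym mr = "mr_word \<Rightarrow>\<^sub>0 complex"
type_synonym mr_tensor = "(mr_word \<times> mr_word) \<Rightarrow>\<^sub>0 complex"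

definition MR :: "nat \<Rightarrow> mr set" where
  "MR l = {x. \<forall>w\<in>Poly_Mapping.keys x. set (letters w) \<subseteq> {(n, i). 1 \<le> n \<and> i < l}}"

definition scale_mr :: "complex \<Rightarrow> mr \<Rightarrow> mr" where
  "scale_mr c x = Poly_Mapping.map ((*) c) x"

definition word_degree :: "mr_word \<Rightarrow> nat" where
  "word_degree w = sum_list (map fst (letters w))"

definition MR_component :: "nat \<Rightarrow> nat \<Rightarrow> mr set" where
  "MR_component l n = {x \<in> MR l. \<forall>w\<in>Poly_Mapping.keys x. word_degree w = n}"

definition S_gen :: "nat \<Rightarrow> nat \<Rightarrow> mr" where
  "S_gen n i = (if n = 0 then 1 else Poly_Mapping.single (Word [(n, i)]) 1)"

definition S_prod :: "colored_comp \<Rightarrow> mr" where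
  "S_prod = (\<lambda>(I, u). prod_list (map2 S_gen I u))"

definition tensor :: "mr \<Rightarrow> mr \<Rightarrow> mr_tensor" where
  "tensor x y = (\<Sum>v\<in>Poly_Mapping.keys x. \<Sum>w\<in>Poly_Mapping.keys y.
     Poly_Mapping.single (v, w) (Poly_Mapping.lookup x v * Poly_Mapping.lookup y w))"

definition coproduct_gen :: "nat \<Rightarrow> nat \<Rightarrow> mr_tensor" where
  "coproduct_gen n i = (\<Sum>p\<le>n. tensor (S_gen p i) (S_gen (n - p) i))"

text \<open>The extension of \<open>coproduct_gen\<close> to an algebra homomorphism; see \<open>coproduct_S_gen\<close>,
  \<open>coproduct_one\<close>, \<open>coproduct_add\<close>, \<open>coproduct_scale\<close> and \<open>coproduct_mult\<close>.\<close>

definition coproduct_word :: "mr_word \<Rightarrow> mr_tensor" where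
  "coproduct_word w = prod_list (map (\<lambda>(n, i). coproduct_gen n i) (letters w))"

definition coproduct :: "mr \<Rightarrow> mr_tensor" where
  "coproduct x = (\<Sum>w\<in>Poly_Mapping.keys x. Poly_Mapping.map ((*) (Poly_Mapping.lookup x w)) (coproduct_word w))"

definition counit :: "mr \<Rightarrow> complex" where
  "counit x = Poly_Mapping.lookup x 0"

lemma map_mult_conv: "Poly_Mapping.map ((*) c) x = Poly_Mapping.single 0 c * x"
  for x :: "'m::monoid_add \<Rightarrow>\<^sub>0 complex"
  by (rule mult_map_scale_conv_mult)

interpretation mr: vector_space scale_mr
  by unfold_locales
     (simp_all add: scale_mr_def map_mult_conv distrib_left distrib_right single_add
        mult_single flip: mult.assoc)

lemma poly_mapping_sum_single_induct:
  fixes x :: "'m \<Rightarrow>\<^sub>0 complex"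
  assumes "\<And>w c. P (Poly_Mapping.single w c)" "\<And>x y. P x \<Longrightarrow> P y \<Longrightarrow> P (x + y)"
  shows "P x"
proof (induction x rule: update_induct)
  case const
  show ?case using assms(1)[of undefined 0] by simp
next
  case (update f a b)
  have "Poly_Mapping.update a b f = f + Poly_Mapping.single a b"
    using update(1) by (intro poly_mapping_eqI)
      (auto simp: lookup_update lookup_add lookup_single in_keys_iff when_def)
  thus ?case using assms update by metis
qed

lemma single_0_central: "Poly_Mapping.single 0 c * x = x * Poly_Mapping.single 0 c"
  for x :: "'m::monoid_add \<Rightarrow>\<^sub>0 complex"
  by (induction x rule: poly_mapping_sum_single_induct)
     (simp_all add: mult_single distrib_left distrib_right mult.commute)

lemma coproduct_superset:
  assumes "finite A" "Poly_Mapping.keys x \<subseteq> A"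
  shows "coproduct x =
    (\<Sum>w\<in>A. Poly_Mapping.single 0 (Poly_Mapping.lookup x w) * coproduct_word w)"
  unfolding coproduct_def map_mult_conv
  by (rule sum.mono_neutral_left) (use assms in \<open>auto simp: in_keys_iff\<close>)

lemma coproduct_add: "coproduct (x + y) = coproduct x + coproduct y"
proof -
  let ?A = "Poly_Mapping.keys x \<union> Poly_Mapping.keys y"
  have "Poly_Mapping.keys (x + y) \<subseteq> ?A" by (rule keys_add)
  thus ?thesis
    by (simp add: coproduct_superset[of ?A] lookup_add single_add distrib_right sum.distrib)
qed

lemma coproduct_single:
  "coproduct (Poly_Mapping.single w c) = Poly_Mapping.single 0 c * coproduct_word w"
  by (subst coproduct_superset[of "{w}"]) (auto simp: lookup_single)

lemma coproduct_word_add: "coproduct_word (v + w) = coproduct_word v * coproduct_word w"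
  by (simp add: coproduct_word_def plus_word_def)

lemma coproduct_one: "coproduct 1 = 1"
  using coproduct_single[of 0 1] by (simp add: coproduct_word_def) (simp add: zero_word_def)

lemma coproduct_mult: "coproduct (x * y) = coproduct x * coproduct y"
proof (induction x rule: poly_mapping_sum_single_induct)
  case (1 v a)
  show ?case
  proof (induction y rule: poly_mapping_sum_single_induct)
    case (1 w b)
    have "Poly_Mapping.single 0 (a * b) * (p * q) =
          Poly_Mapping.single 0 a * p * (Poly_Mapping.single 0 b * q)" for p q :: mr_tensor
    proof -
      have "Poly_Mapping.single 0 a * p * (Poly_Mapping.single 0 b * q) =
            Poly_Mapping.single 0 a * (p * Poly_Mapping.single 0 b) * q"
        by (simp add: mult.assoc)
      also have "p * Poly_Mapping.single 0 b = Poly_Mapping.single 0 b * p"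
        by (rule single_0_central[symmetric])
      finally show ?thesis
        using mult_single[of "0 :: mr_word \<times> mr_word" a 0 b] by (simp flip: mult.assoc)
    qed
    thus ?case by (simp add: mult_single coproduct_single coproduct_word_add)
  qed (simp add: coproduct_add distrib_left)
qed (simp add: coproduct_add distrib_right)

lemma coproduct_scale:
  "coproduct (scale_mr c x) = Poly_Mapping.map ((*) c) (coproduct x)"
  using coproduct_mult[of "Poly_Mapping.single 0 c" x] coproduct_one
  by (simp add: scale_mr_def map_mult_conv coproduct_single coproduct_word_def zero_word_def)

lemma coproduct_S_gen:
  "coproduct (S_gen n i) = (\<Sum>p\<le>n. tensor (S_gen p i) (S_gen (n - p) i))"
proof (cases "n = 0")
  case True
  have "tensor 1 1 = 1" by (simp add: tensor_def zero_prod_def flip: single_one)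
  thus ?thesis using True by (simp add: S_gen_def coproduct_one)
next
  case False
  thus ?thesis by (simp add: S_gen_def coproduct_single coproduct_word_def coproduct_gen_def)
qed

section \<open>The graded dual\<close>

text \<open>Functionals on the subspace \<open>MR l\<close> are represented by functions that are
  \<open>undefined\<close> outside it, so that equality of functionals is equality of functions.\<close>

definition MR_functionals :: "nat \<Rightarrow> (mr \<Rightarrow> complex) set" where
  "MR_functionals l =
     {\<phi> \<in> extensional (MR l).
        (\<forall>x\<in>MR l. \<forall>y\<in>MR l. \<phi> (x + y) = \<phi> x + \<phi> y) \<and>
        (\<forall>c. \<forall>x\<in>MR l. \<phi> (scale_mr c x) = c * \<phi> x)}"

definition dual_component :: "nat \<Rightarrow> nat \<Rightarrow> (mr \<Rightarrow> complex) set" where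
  "dual_component l n =
     {\<phi> \<in> MR_functionals l. \<forall>k. k \<noteq> n \<longrightarrow> (\<forall>x\<in>MR_component l k. \<phi> x = 0)}"

definition graded_dual :: "nat \<Rightarrow> (mr \<Rightarrow> complex) set" where
  "graded_dual l =
     {\<phi> \<in> MR_functionals l. \<exists>N. \<forall>k>N. \<forall>x\<in>MR_component l k. \<phi> x = 0}"

definition tensor_functional :: "(mr \<Rightarrow> complex) \<Rightarrow> (mr \<Rightarrow> complex) \<Rightarrow> mr_tensor \<Rightarrow> complex" where
  "tensor_functional \<phi> \<psi> t = (\<Sum>(v, w)\<in>Poly_Mapping.keys t. Poly_Mapping.lookup t (v, w) *
     (\<phi> (Poly_Mapping.single v 1) * \<psi> (Poly_Mapping.single w 1)))"

text \<open>The product of the graded dual is the transpose of the coproduct, its unit the counit.\<close>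

definition dual_mult :: "nat \<Rightarrow> (mr \<Rightarrow> complex) \<Rightarrow> (mr \<Rightarrow> complex) \<Rightarrow> mr \<Rightarrow> complex" where
  "dual_mult l \<phi> \<psi> = restrict (\<lambda>x. tensor_functional \<phi> \<psi> (coproduct x)) (MR l)"

definition dual_one :: "nat \<Rightarrow> mr \<Rightarrow> complex" where
  "dual_one l = restrict counit (MR l)"

definition bilinear_pairing :: "mseries set \<Rightarrow> mr set \<Rightarrow> (mseries \<Rightarrow> mr \<Rightarrow> complex) \<Rightarrow> bool" where
  "bilinear_pairing A B b \<longleftrightarrow>
     (\<forall>f\<in>A. \<forall>g\<in>A. \<forall>x\<in>B. b (f + g) x = b f x + b g x) \<and>
     (\<forall>c. \<forall>f\<in>A. \<forall>x\<in>B. b (scale_mseries c f) x = c * b f x) \<and>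
     (\<forall>f\<in>A. \<forall>x\<in>B. \<forall>y\<in>B. b f (x + y) = b f x + b f y) \<and>
     (\<forall>c. \<forall>f\<in>A. \<forall>x\<in>B. b f (scale_mr c x) = c * b f x)"

text \<open>Linearity of \<open>f \<mapsto> b f\<close> for the pointwise operations on functionals is part of
  \<open>bilinear_pairing\<close>.\<close>

definition identifies_with_graded_dual ::
    "nat \<Rightarrow> mseries set \<Rightarrow> (mseries \<Rightarrow> mr \<Rightarrow> complex) \<Rightarrow> bool" where
  "identifies_with_graded_dual l A b \<longleftrightarrow>
     (let \<Phi> = (\<lambda>f. restrict (b f) (MR l)) in
        bilinear_pairing A (MR l) b \<and>
        bij_betw \<Phi> A (graded_dual l) \<and>
        \<Phi> 1 = dual_one l \<and>
        (\<forall>f\<in>A. \<forall>g\<in>A. \<Phi> (f * g) = dual_mult l (\<Phi> f) (\<Phi> g)) \<and>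
        (\<forall>n. \<Phi> ` (A \<inter> residue_class ` homogeneous_series n) = dual_component l n))"

definition kronecker :: "'a \<Rightarrow> 'a \<Rightarrow> complex" where
  "kronecker a b = (if a = b then 1 else 0)"

end

theory Submission
  imports Defs
begin

text \<open>Allowing zero parts, every monomial without mixed colors comes from a weak colored
  composition placed at the positions \<open>1, 2, \<dots>\<close>, and the span of the \<open>M\<^sub>(\<^sub>I\<^sub>,\<^sub>u\<^sub>)\<close> consists of the
  classes of the series of bounded degree whose coefficients do not change when zero parts are
  deleted. The pairing evaluates a word \<open>S\<^sup>(\<^sup>I\<^sup>,\<^sup>u\<^sup>)\<close> at a series by taking the coefficient of the
  corresponding monomial. A factorization of this monomial splits each part as \<open>p + q\<close> keeping
  its color, and so does a term of the coproduct of the word; hence the product of series is the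
  transpose of the coproduct.\<close>

section \<open>Monomials of weak colored compositions\<close>

text \<open>A zero part leaves its position empty and its color leaves no trace, so lists with
  different colors on zero parts, or with extra trailing zero parts, give the same monomial. The
  starting position \<open>k\<close> serves the inductions; coefficients of series are later read
  off at start 1.\<close>

primrec mono_from :: "nat \<Rightarrow> (nat \<times> nat) list \<Rightarrow> monomial" where
  "mono_from k [] = 0"
| "mono_from k (x # ws) = Poly_Mapping.single (k, snd x) (fst x) + mono_from (Suc k) ws"

abbreviation strip :: "(nat \<times> nat) list \<Rightarrow> (nat \<times> nat) list" where
  "strip \<equiv> filter (\<lambda>x. 0 < fst x)"

abbreviation degree_list :: "(nat \<times> nat) list \<Rightarrow> nat" where
  "degree_list ws \<equiv> sum_list (map fst ws)"

lemma lookup_mono_from_below: "j < k \<Longrightarrow> Poly_Mapping.lookup (mono_from k ws) (j, c) = 0"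
  by (induction ws arbitrary: k) (auto simp: lookup_add lookup_single)

lemma lookup_mono_from:
  "Poly_Mapping.lookup (mono_from k ws) (j, c) =
     (if k \<le> j \<and> j < k + length ws \<and> snd (ws ! (j - k)) = c then fst (ws ! (j - k)) else 0)"
proof (induction ws arbitrary: k)
  case (Cons x ws)
  show ?case
  proof (cases "j = k")
    case True
    thus ?thesis by (simp add: lookup_add lookup_single lookup_mono_from_below)
  next
    case False
    moreover have "(x # ws) ! (j - k) = ws ! (j - Suc k)" if "k < j"
      using that by (simp add: nth_Cons')
    ultimately show ?thesis
      by (auto simp: lookup_add lookup_single Cons.IH)
  qed
qed simp

text \<open>Each position carries one entry of the list, hence one color. This makes coefficients at
  such monomials insensitive to \<open>mixed_ideal\<close>.\<close>

lemma mono_from_not_mixed: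
  "(j, p) \<in> Poly_Mapping.keys (mono_from k ws) \<Longrightarrow>
   (j, q) \<in> Poly_Mapping.keys (mono_from k ws) \<Longrightarrow> p = q"
  by (auto simp: in_keys_iff lookup_mono_from split: if_splits)

lemma monomial_degree_0: "monomial_degree 0 = 0"
  by (simp add: monomial_degree_def)

lemma monomial_degree_single: "monomial_degree (Poly_Mapping.single v n) = n"
  by (simp add: monomial_degree_def)

lemma monomial_degree_mono_from: "monomial_degree (mono_from k ws) = degree_list ws"
  by (induction ws arbitrary: k)
     (simp_all add: monomial_degree_0 monomial_degree_add monomial_degree_single)

lemma mono_from_eq_0_iff: "mono_from k ws = 0 \<longleftrightarrow> strip ws = []"
proof
  assume "mono_from k ws = 0"
  hence "degree_list ws = 0"
    by (metis monomial_degree_mono_from monomial_degree_0)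
  thus "strip ws = []" by (simp add: filter_empty_conv)
next
  assume "strip ws = []"
  thus "mono_from k ws = 0"
    by (induction ws arbitrary: k) (auto split: if_splits)
qed

text \<open>Below a bound on the occurring indices, each position is recorded by its unique color
  and the exponent there; positions without a variable become zero parts.\<close>

lemma unmixed_monomial_eq_mono_from:
  assumes keys: "Poly_Mapping.keys m \<subseteq> {(j, c). 1 \<le> j}"
    and unmixed: "\<And>j p q. (j, p) \<in> Poly_Mapping.keys m \<Longrightarrow> (j, q) \<in> Poly_Mapping.keys m \<Longrightarrow> p = q"
  obtains ws where "m = mono_from 1 ws"
proof -
  \<comment> \<open>At a position without variables the choice is arbitrary, which is harmless
    because the exponent read off there is 0.\<close>
  define color where "color j = (SOME c. (j, c) \<in> Poly_Mapping.keys m)" for j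
  obtain N where N: "\<And>j c. (j, c) \<in> Poly_Mapping.keys m \<Longrightarrow> j \<le> N"
    using Max_ge[of "fst ` Poly_Mapping.keys m"] by (metis finite_imageI finite_keys image_eqI fst_conv)
  have color: "color j = c" if "(j, c) \<in> Poly_Mapping.keys m" for j c
    using that unmixed unfolding color_def by (metis someI_ex)
  define ws where "ws = map (\<lambda>j. (Poly_Mapping.lookup m (Suc j, color (Suc j)), color (Suc j))) [0..<N]"
  have "Poly_Mapping.lookup m (j, c) = Poly_Mapping.lookup (mono_from 1 ws) (j, c)" for j c
  proof (cases "(j, c) \<in> Poly_Mapping.keys m")
    case True
    hence "1 \<le> j" "j \<le> N" "color j = c" using keys N color by auto
    thus ?thesis by (cases j) (simp_all add: lookup_mono_from ws_def)
  next
    case False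
    thus ?thesis by (auto simp: lookup_mono_from ws_def in_keys_iff)
  qed
  hence "m = mono_from 1 ws" by (intro poly_mapping_eqI) auto
  thus thesis by (rule that)
qed

section \<open>Splittings of weak compositions\<close>

text \<open>Describes both the factorizations of a monomial and the coproduct of a word.\<close>

primrec split_sum ::
    "(nat \<times> nat) list \<Rightarrow> ((nat \<times> nat) list \<Rightarrow> (nat \<times> nat) list \<Rightarrow> 'a) \<Rightarrow> 'a::comm_monoid_add" where
  "split_sum [] H = H [] []"
| "split_sum (x # ws) H =
     (\<Sum>p\<le>fst x. split_sum ws (\<lambda>a b. H ((p, snd x) # a) ((fst x - p, snd x) # b)))"

text \<open>Both halves of a splitting inherit the colors of \<open>ws\<close>. This is what later
  keeps the colors of the halves below \<open>l\<close>.\<close>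

lemma split_sum_cong:
  assumes "\<And>a b. map snd a = map snd ws \<Longrightarrow> map snd b = map snd ws \<Longrightarrow> H a b = K a b"
  shows "split_sum ws H = split_sum ws K"
  using assms
proof (induction ws arbitrary: H K)
  case (Cons x ws)
  show ?case by (auto intro!: sum.cong Cons.IH Cons.prems)
qed simp

text \<open>A zero part splits only as 0 + 0 and so adds a zero part to both halves, which
  \<open>strip\<close> removes. \<open>H\<close> must see stripped halves because a nonzero part can
  also leave a zero part in one half.\<close>

lemma split_sum_strip:
  "split_sum ws (\<lambda>a b. H (strip a) (strip b)) =
   split_sum (strip ws) (\<lambda>a b. H (strip a) (strip b))"
proof (induction ws arbitrary: H)
  case (Cons x ws)
  have IH: "split_sum ws (\<lambda>a b. H (u @ strip a) (v @ strip b)) =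
      split_sum (strip ws) (\<lambda>a b. H (u @ strip a) (v @ strip b))" for u v
    using Cons.IH[of "\<lambda>a b. H (u @ a) (v @ b)"] .
  \<comment> \<open>What remains of a head entry after stripping; it is the prefix with which the
    induction hypothesis is instantiated.\<close>
  define u where "u y = (if fst y = 0 then [] else [y])" for y :: "nat \<times> nat"
  have *: "strip (y # a) = u y @ strip a" for y a by (simp add: u_def)
  show ?case
  proof (cases "fst x = 0")
    case True
    thus ?thesis using IH[of "[]" "[]"] by simp
  next
    case False
    hence "strip (x # ws) = x # strip ws" by simp
    thus ?thesis by (simp only: split_sum.simps * IH)
  qed
qed simp

lemma split_sum_hom:
  assumes "T 0 = 0" "\<And>x y. T (x + y) = T x + T y"
  shows "T (split_sum ws H) = split_sum ws (\<lambda>a b. T (H a b))"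
proof (induction ws arbitrary: H)
  case (Cons x ws)
  have "T (\<Sum>p\<in>A. F p) = (\<Sum>p\<in>A. T (F p))" for A :: "nat set" and F
    by (induction A rule: infinite_finite_induct) (simp_all add: assms)
  thus ?case by (simp add: Cons.IH)
qed simp

text \<open>In a factorization the exponent of the first variable is shared out as \<open>p\<close>
  and \<open>n - p\<close>, and the rest, supported on later positions, factors
  independently.\<close>

lemma sum_decompositions_mono_from:
  "(\<Sum>(a, b)\<in>{(a, b). a + b = mono_from k ws}. h a b) =
     split_sum ws (\<lambda>a b. h (mono_from k a) (mono_from k b))"
proof (induction ws arbitrary: k h)
  case Nil
  have "{(a, b). a + b = (0 :: monomial)} = {(0, 0)}"
  proof -
    have "a = 0 \<and> b = 0" if "a + b = 0" for a b :: monomial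
    proof -
      have "Poly_Mapping.lookup a v + Poly_Mapping.lookup b v = 0" for v
        using arg_cong[OF that, of "\<lambda>m. Poly_Mapping.lookup m v"] by (simp add: lookup_add)
      thus ?thesis by (auto intro!: poly_mapping_eqI)
    qed
    hence "a + b = 0 \<longleftrightarrow> a = 0 \<and> b = 0" for a b :: monomial by (metis add_0)
    thus ?thesis by auto
  qed
  thus ?case by simp
next
  case (Cons x ws)
  obtain n c where x: "x = (n, c)" by force
  let ?s = "\<lambda>p. Poly_Mapping.single (k, c) (p :: nat)"
  let ?D = "{(a, b). a + b = mono_from (Suc k) ws}"
  let ?e = "\<lambda>m :: monomial. Poly_Mapping.lookup m (k, c)"
  \<comment> \<open>Factors of the tail do not involve the variable at \<open>(k, c)\<close>, so its
    exponent in a product with \<open>?s p\<close> is exactly \<open>p\<close>.\<close>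
  have zero: "?e a = 0 \<and> ?e b = 0"
    if "a + b = mono_from (Suc k) ws" for a b
    using arg_cong[OF that, of ?e]
    by (simp add: lookup_add lookup_mono_from_below)
  have sub': "?s (?e a) + (a - ?s (?e a)) = a" for a :: monomial
    by (rule poly_mapping_eqI) (auto simp: lookup_add lookup_minus lookup_single when_def)
  have sub: "(a - ?s (?e a)) + ?s (?e a) = a" for a :: monomial
    by (subst add.commute) (rule sub')
  have "(\<Sum>(a, b)\<in>{(a, b). a + b = mono_from k (x # ws)}. h a b) =
        (\<Sum>(p, a, b)\<in>{..n} \<times> ?D. h (?s p + a) (?s (n - p) + b))"
  \<comment> \<open>One map removes the variable \<open>(k, c)\<close> from both factors and
    remembers its exponent in the first; the other multiplies it back.\<close>
  proof (rule sum.reindex_bij_witness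
      [where i = "\<lambda>(p, a, b). (?s p + a, ?s (n - p) + b)"
         and j = "\<lambda>(a, b). (?e a, a - ?s (?e a), b - ?s (?e b))"],
      goal_cases)
    case (1 q)
    then obtain a b where q: "q = (a, b)" "a + b = ?s n + mono_from (Suc k) ws" by (auto simp: x)
    have n: "?e a + ?e b = n"
      using arg_cong[OF q(2), of ?e]
      by (simp add: lookup_add lookup_mono_from_below)
    hence "n - ?e a = ?e b" by simp
    thus ?case by (simp only: q prod.case sub')
  next
    case (2 q)
    then obtain a b where q: "q = (a, b)" "a + b = ?s n + mono_from (Suc k) ws" by (auto simp: x)
    have n: "?e a + ?e b = n"
      using arg_cong[OF q(2), of ?e]
      by (simp add: lookup_add lookup_mono_from_below)
    have "?s n = ?s (?e a) + ?s (?e b)"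
      by (simp add: n flip: single_add)
    \<comment> \<open>Subtraction of exponents is truncated, so the identity is obtained by adding
      \<open>?s n\<close> on both sides and cancelling it.\<close>
    hence "(a - ?s (?e a)) + (b - ?s (?e b)) + ?s n =
        (a - ?s (?e a) + ?s (?e a)) +
        (b - ?s (?e b) + ?s (?e b))"
      by (simp only: ac_simps)
    hence "(a - ?s (?e a)) + (b - ?s (?e b)) + ?s n = a + b"
      by (simp only: sub)
    hence "(a - ?s (?e a)) + (b - ?s (?e b)) = mono_from (Suc k) ws"
      unfolding q(2) by (metis add.commute add_right_cancel)
    thus ?case using n by (auto simp: q)
  next
    case (3 q)
    then obtain p a b where q: "q = (p, a, b)" "a + b = mono_from (Suc k) ws" by auto
    thus ?case using zero[OF q(2)] by (simp add: lookup_add)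
  next
    case (4 q)
    then obtain p a b where q: "q = (p, a, b)" "p \<le> n" "a + b = mono_from (Suc k) ws" by auto
    have "(?s p + a) + (?s (n - p) + b) = (?s p + ?s (n - p)) + (a + b)"
      by (simp add: ac_simps)
    also have "?s p + ?s (n - p) = ?s n" using q(2) by (simp flip: single_add)
    finally show ?case by (simp add: q x)
  next
    case (5 q)
    then obtain a b where q: "q = (a, b)" "a + b = ?s n + mono_from (Suc k) ws" by (auto simp: x)
    have n: "?e a + ?e b = n"
      using arg_cong[OF q(2), of ?e]
      by (simp add: lookup_add lookup_mono_from_below)
    hence "n - ?e a = ?e b" by simp
    thus ?case by (simp only: q prod.case sub')
  qed
  also have "\<dots> = (\<Sum>p\<le>n. \<Sum>(a, b)\<in>?D. h (?s p + a) (?s (n - p) + b))"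
    by (simp add: sum.cartesian_product)
  also have "\<dots> = split_sum (x # ws) (\<lambda>a b. h (mono_from k a) (mono_from k b))"
    using Cons.IH[of "\<lambda>a b. h (?s p + a) (?s (n - p) + b)" "Suc k" for p] by (simp add: x)
  finally show ?case .
qed

lemma coeff_mult_mono_from:
  "coeff (f * g) (mono_from k ws) =
     split_sum ws (\<lambda>a b. coeff f (mono_from k a) * coeff g (mono_from k b))"
  by (simp add: times_pseries_def sum_decompositions_mono_from)

section \<open>The coproduct of a word\<close>

lemma S_gen_eq_single: "S_gen n i = Poly_Mapping.single (Word (strip [(n, i)])) 1"
  by (simp add: S_gen_def flip: zero_word_def)

lemma tensor_single:
  "tensor (Poly_Mapping.single v 1) (Poly_Mapping.single w 1) = Poly_Mapping.single (v, w) 1"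
  by (simp add: tensor_def)

text \<open>The coproduct of a generator splits its degree as \<open>p\<close> and
  \<open>n - p\<close> with the same color, and multiplicativity makes the splittings of the letters
  independent. Factors of degree 0 equal 1, which \<open>strip\<close> expresses by deleting the
  letter.\<close>

lemma coproduct_word_eq_split_sum:
  "coproduct_word (Word ws) =
     split_sum ws (\<lambda>a b. Poly_Mapping.single (Word (strip a), Word (strip b)) 1)"
proof (induction ws)
  case Nil
  have "coproduct_word (Word []) = 1" by (simp add: coproduct_word_def)
  thus ?case by (simp flip: zero_word_def zero_prod_def)
next
  case (Cons x ws)
  obtain n c where x: "x = (n, c)" by force
  let ?w = "\<lambda>p. Word (strip [(p, c)])"
  have "coproduct_word (Word (x # ws)) = coproduct_gen n c * coproduct_word (Word ws)"
    by (simp add: coproduct_word_def x)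
  also have "\<dots> = (\<Sum>p\<le>n. Poly_Mapping.single (?w p, ?w (n - p)) 1 * coproduct_word (Word ws))"
    by (simp only: coproduct_gen_def S_gen_eq_single tensor_single sum_distrib_right)
  also have "\<dots> = (\<Sum>p\<le>n. split_sum ws (\<lambda>a b. Poly_Mapping.single (?w p, ?w (n - p)) 1 *
      Poly_Mapping.single (Word (strip a), Word (strip b)) 1))"
    unfolding Cons.IH
    \<comment> \<open>Left multiplication by a fixed tensor is additive, hence passes inside the
      splitting sum.\<close>
    by (intro sum.cong refl split_sum_hom[where T = "\<lambda>t. Poly_Mapping.single (?w _, ?w _) 1 * t"])
       (simp_all add: distrib_left)
  also have "\<dots> = split_sum (x # ws) (\<lambda>a b. Poly_Mapping.single (Word (strip a), Word (strip b)) 1)"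
    by (auto simp: x mult_single plus_word_def intro!: sum.cong split_sum_cong)
  finally show ?case .
qed

section \<open>Monomial quasi-symmetric functions\<close>

text \<open>A colored composition in zipped form, which is also the form of the words spanning
  \<open>MR l\<close>.\<close>

definition positive_word :: "nat \<Rightarrow> (nat \<times> nat) list \<Rightarrow> bool" where
  "positive_word l w \<longleftrightarrow> set w \<subseteq> {(n, i). 1 \<le> n \<and> i < l}"

lemma strip_positive_word: "positive_word l w \<Longrightarrow> strip w = w"
  by (auto simp: positive_word_def filter_id_conv)

primrec positions :: "nat \<Rightarrow> (nat \<times> nat) list \<Rightarrow> nat list" where
  "positions k [] = []"
| "positions k (x # ws) = (if fst x = 0 then positions (Suc k) ws else k # positions (Suc k) ws)"

text \<open>The monomial contributed to \<open>M_qsym\<close> by the index list \<open>js\<close>.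
  Positions are explicit here, whereas \<open>mono_from\<close> encodes gaps by zero parts;
  \<open>positions\<close> translates between the two.\<close>

definition mono_at :: "nat list \<Rightarrow> (nat \<times> nat) list \<Rightarrow> monomial" where
  "mono_at js w = (\<Sum>(j, x)\<leftarrow>zip js w. Poly_Mapping.single (j, snd x) (fst x))"

lemma mono_at_Nil: "mono_at [] w = 0"
  by (simp add: mono_at_def)

lemma mono_at_Cons: "mono_at (j # js) (x # w) = Poly_Mapping.single (j, snd x) (fst x) + mono_at js w"
  by (simp add: mono_at_def)

lemma positions_ge: "j \<in> set (positions k ws) \<Longrightarrow> k \<le> j"
  by (induction ws arbitrary: k) (auto split: if_splits dest: Suc_leD)

lemma sorted_positions: "sorted_wrt (<) (positions k ws)"
  by (induction ws arbitrary: k) (auto dest: positions_ge)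

lemma length_positions: "length (positions k ws) = length (strip ws)"
  by (induction ws arbitrary: k) auto

lemma mono_at_positions: "mono_at (positions k ws) (strip ws) = mono_from k ws"
  by (induction ws arbitrary: k) (simp_all add: mono_at_Nil mono_at_Cons)

lemma lookup_mono_at_below:
  "\<forall>i\<in>set js. j < i \<Longrightarrow> Poly_Mapping.lookup (mono_at js w) (j, c) = 0"
  unfolding mono_at_def
  by (induction js w rule: list_induct2') (auto simp: lookup_add lookup_single)

lemma keys_mono_at: "Poly_Mapping.keys (mono_at js w) \<subseteq> set js \<times> snd ` set w"
  unfolding mono_at_def
proof (induction js w rule: list_induct2')
  case (4 j js x w)
  have "Poly_Mapping.keys (Poly_Mapping.single (j, snd x) (fst x)) \<subseteq> {(j, snd x)}" by simp
  with 4 keys_add[of "Poly_Mapping.single (j, snd x) (fst x)"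
    "\<Sum>(j, x)\<leftarrow>zip js w. Poly_Mapping.single (j, snd x) (fst x)"]
  show ?case by auto
qed simp_all

lemma monomial_degree_mono_at:
  "length js = length w \<Longrightarrow> monomial_degree (mono_at js w) = degree_list w"
  by (induction js w rule: list_induct2)
     (simp_all add: mono_at_def monomial_degree_0 monomial_degree_add monomial_degree_single)

text \<open>The placement is read off position by position. If \<open>k\<close> is used, it is the
  first index, and its exponent determines the first entry of \<open>w\<close>; otherwise the
  exponent at \<open>k\<close> vanishes and \<open>ws\<close> begins with a zero part.\<close>

lemma mono_at_eq_mono_from_imp:
  assumes "mono_at js w = mono_from k ws" "length js = length w" "\<forall>x\<in>set w. fst x \<noteq> 0"
    "sorted_wrt (<) js" "\<forall>j\<in>set js. k \<le> j"
  shows "js = positions k ws \<and> w = strip ws"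
  using assms
proof (induction ws arbitrary: js w k)
  case Nil
  \<comment> \<open>Nonzero parts of total degree 0 can only form the empty list.\<close>
  have "degree_list w = 0"
    using Nil by (metis monomial_degree_mono_at mono_from.simps(1) monomial_degree_0)
  with Nil(3) have "w = []" by (cases w) auto
  with Nil(2) show ?case by simp
next
  case (Cons x ws)
  show ?case
  proof (cases "k \<in> set js")
    case True
    then obtain js' where js: "js = k # js'"
      using Cons.prems(4,5) by (cases js) auto
    then obtain y w' where w: "w = y # w'" using Cons.prems(2) by (cases w) auto
    have above: "\<forall>j\<in>set js'. k < j" using Cons.prems(4) js by simp
    have "Poly_Mapping.lookup (mono_at js w) (k, snd y) = fst y"
      using lookup_mono_at_below[OF above] by (simp add: js w mono_at_Cons lookup_add)
    moreover have "Poly_Mapping.lookup (mono_from k (x # ws)) (k, snd y) =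
        (if snd y = snd x then fst x else 0)"
      by (auto simp: lookup_add lookup_single lookup_mono_from_below)
    moreover have "fst y \<noteq> 0" using Cons.prems(3) w by simp
    \<comment> \<open>The exponent \<open>fst y\<close> is nonzero, which rules out different
      colors.\<close>
    ultimately have xy: "x = y" using Cons.prems(1) by (auto simp: prod_eq_iff split: if_splits)
    hence "mono_at js' w' = mono_from (Suc k) ws"
      using Cons.prems(1) by (simp add: js w mono_at_Cons)
    hence "js' = positions (Suc k) ws \<and> w' = strip ws"
      by (rule Cons.IH) (use Cons.prems above js w in auto)
    thus ?thesis using \<open>fst y \<noteq> 0\<close> by (simp add: js w xy)
  next
    case False
    hence above: "\<forall>j\<in>set js. k < j"
      using Cons.prems(5) by (metis order_le_imp_less_or_eq)
    have "Poly_Mapping.lookup (mono_from k (x # ws)) (k, snd x) = fst x"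
      by (simp add: lookup_add lookup_mono_from_below)
    hence "fst x = 0"
      using lookup_mono_at_below[OF above] Cons.prems(1) by metis
    moreover from this have "mono_at js w = mono_from (Suc k) ws" using Cons.prems(1) by simp
    hence "js = positions (Suc k) ws \<and> w = strip ws"
      by (rule Cons.IH) (use Cons.prems above in auto)
    ultimately show ?thesis by simp
  qed
qed

lemma prod_var_power:
  assumes "length js = length I" "length u = length I"
  shows "(\<Prod>k<length I. var (js ! k) (u ! k) ^ (I ! k)) = mono_series (mono_at js (zip I u))"
proof -
  have "mono_at js (zip I u) = (\<Sum>k<length I. Poly_Mapping.single (js ! k, u ! k) (I ! k))"
    using assms by (simp add: mono_at_def sum_list_sum_nth atLeast0LessThan)
  thus ?thesis by (simp add: var_power prod_mono_series)
qed

text \<open>Every index list contributes one monomial with coefficient 1, so the coefficient counts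
  lists. Sums of ones and \<open>card\<close> are both 0 on infinite sets, so they agree in every
  case.\<close>

lemma coeff_M_qsym:
  assumes "length I = length u"
  shows "coeff (M_qsym (I, u)) m =
    of_nat (card {js. length js = length I \<and> (\<forall>j\<in>set js. 1 \<le> j) \<and> sorted_wrt (<) js \<and>
      mono_at js (zip I u) = m})"
proof -
  let ?A = "{js. length js = length I \<and> (\<forall>j\<in>set js. 1 \<le> j) \<and> sorted_wrt (<) js}"
  let ?F = "\<lambda>js. \<Prod>k<length I. var (js ! k) (u ! k) ^ (I ! k)"
  have F: "coeff (?F js) m = (if mono_at js (zip I u) = m then 1 else 0)" if "js \<in> ?A" for js
  proof -
    have "length js = length I" "length u = length I" using that assms by auto
    from prod_var_power[OF this] show ?thesis
      by (simp only: mono_series_def coeff_Pseries) (simp add: eq_commute)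
  qed
  have "coeff (M_qsym (I, u)) m = (\<Sum>js\<in>{js \<in> ?A. coeff (?F js) m \<noteq> 0}. coeff (?F js) m)"
    by (simp add: M_qsym_def formal_sum_def)
  also have "\<dots> = (\<Sum>js\<in>{js \<in> ?A. mono_at js (zip I u) = m}. 1)"
    by (rule sum.cong) (use F in \<open>auto split: if_splits\<close>)
  finally show ?thesis by (simp add: conj_assoc)
qed

text \<open>The only index list that can contribute is \<open>positions 1 ws\<close>. The formula
  gives both the invariance under zero parts and the Kronecker symbols of the pairing.\<close>

lemma coeff_M_qsym_mono_from:
  assumes "(I, u) \<in> colored_compositions l"
  shows "coeff (M_qsym (I, u)) (mono_from (Suc 0) ws) = (if strip ws = zip I u then 1 else 0)"
proof -
  have len: "length I = length u" and I: "\<forall>i\<in>set I. 1 \<le> i"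
    using assms by (simp_all add: colored_compositions_def)
  have pos: "\<forall>x\<in>set (zip I u). fst x \<noteq> 0"
  proof
    fix x assume "x \<in> set (zip I u)"
    hence "fst x \<in> set I" by (metis prod.collapse set_zip_leftD)
    thus "fst x \<noteq> 0" using I by auto
  qed
  let ?P = "\<lambda>js. length js = length I \<and> (\<forall>j\<in>set js. 1 \<le> j) \<and> sorted_wrt (<) js \<and>
      mono_at js (zip I u) = mono_from 1 ws"
  have "?P js \<longleftrightarrow> strip ws = zip I u \<and> js = positions 1 ws" for js
  proof
    assume "?P js"
    thus "strip ws = zip I u \<and> js = positions 1 ws"
      using mono_at_eq_mono_from_imp[of js "zip I u" 1 ws] len pos by simp
  next
    assume eq: "strip ws = zip I u \<and> js = positions 1 ws"
    hence "length js = length I" using len by (simp add: length_positions)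
    moreover have "mono_at js (zip I u) = mono_from 1 ws"
      using eq mono_at_positions[of 1 ws] by simp
    ultimately show "?P js"
      using eq sorted_positions positions_ge by blast
  qed
  hence "{js. ?P js} = (if strip ws = zip I u then {positions 1 ws} else {})"
    by (simp add: Collect_conv_if)
  thus ?thesis
    unfolding One_nat_def[symmetric] by (simp only: coeff_M_qsym[OF len]) simp
qed

lemma coeff_M_qsym_nonzero:
  assumes "(I, u) \<in> colored_compositions l" "coeff (M_qsym (I, u)) m \<noteq> 0"
  shows "monomial_degree m = degree_list (zip I u) \<and> Poly_Mapping.keys m \<subseteq> {(j, c). 1 \<le> j \<and> c < l}"
proof -
  have len: "length I = length u" and u: "\<forall>c\<in>set u. c < l"
    using assms(1) by (auto simp: colored_compositions_def)
  let ?S = "{js. length js = length I \<and> (\<forall>j\<in>set js. 1 \<le> j) \<and> sorted_wrt (<) js \<and>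
      mono_at js (zip I u) = m}"
  have "card ?S \<noteq> 0"
    using assms(2) by (simp add: coeff_M_qsym[OF len])
  hence "?S \<noteq> {}" by (intro notI) (simp only: card.empty)
  then obtain js where js: "length js = length I" "\<forall>j\<in>set js. 1 \<le> j" "mono_at js (zip I u) = m"
    by blast
  have "Poly_Mapping.keys m \<subseteq> set js \<times> snd ` set (zip I u)"
    using keys_mono_at[of js "zip I u"] js(3) by simp
  moreover have "snd ` set (zip I u) \<subseteq> set u"
    using set_zip_rightD by fastforce
  ultimately have "Poly_Mapping.keys m \<subseteq> {(j, c). 1 \<le> j \<and> c < l}"
    using js(2) u by blast
  moreover have "monomial_degree m = degree_list (zip I u)"
    using monomial_degree_mono_at[of js "zip I u"] js len by simp
  ultimately show ?thesis by blast
qed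

section \<open>Quasi-symmetric series\<close>

text \<open>Quasi-symmetry: moving the indices apart or together only inserts or deletes zero parts.
  The second condition does not touch mixed monomials, whose coefficients vanish in the quotient
  anyway.\<close>

definition qsym_series :: "nat \<Rightarrow> pseries set" where
  "qsym_series l = {f \<in> bounded_series l.
     \<forall>ws. coeff f (mono_from 1 ws) = coeff f (mono_from 1 (strip ws))}"

text \<open>A coefficient of the product is a sum over splittings in which quasi-symmetry lets both
  halves be stripped; such a sum ignores zero parts of the list. Since mixed monomials are allowed
  here, closure already holds before passing to the quotient.\<close>

lemma qsym_series_mult:
  assumes "f \<in> qsym_series l" "g \<in> qsym_series l"
  shows "f * g \<in> qsym_series l"
proof -
  have "f * g \<in> bounded_series l"
    using assms bounded_series_subalgebra by (auto simp: is_subalgebra_def qsym_series_def)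
  moreover have "coeff (f * g) (mono_from 1 ws) = coeff (f * g) (mono_from 1 (strip ws))" for ws
  proof -
    have *: "coeff (f * g) (mono_from 1 vs) = split_sum vs
        (\<lambda>a b. coeff f (mono_from 1 (strip a)) * coeff g (mono_from 1 (strip b)))" for vs
      unfolding coeff_mult_mono_from
      using assms by (intro split_sum_cong arg_cong2[where f = "(*)"]) (simp_all add: qsym_series_def)
    show ?thesis
      unfolding * by (rule split_sum_strip)
  qed
  ultimately show ?thesis by (simp add: qsym_series_def)
qed

lemma qsym_series_one: "1 \<in> qsym_series l"
proof -
  have "1 \<in> bounded_series l"
    using bounded_series_subalgebra by (auto simp: is_subalgebra_def)
  thus ?thesis by (simp add: qsym_series_def one_pseries_def mono_from_eq_0_iff)
qed

lemma qsym_series_subspace: "pseries.subspace (qsym_series l)"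
proof -
  have "pseries.subspace (bounded_series l)"
    using bounded_series_subalgebra by (auto simp: is_subalgebra_def)
  thus ?thesis
    by (auto simp: pseries.subspace_def qsym_series_def zero_pseries_def plus_pseries_def scale_pseries_def)
qed

lemma M_qsym_in_qsym_series:
  assumes "Iu \<in> colored_compositions l"
  shows "M_qsym Iu \<in> qsym_series l"
proof -
  obtain I u where Iu: "Iu = (I, u)" by force
  have "M_qsym (I, u) \<in> bounded_series l"
    unfolding bounded_series_def
    using coeff_M_qsym_nonzero[of I u l] assms Iu by (blast intro: eq_imp_le)
  thus ?thesis
    using assms coeff_M_qsym_mono_from[of I u l] by (simp add: Iu qsym_series_def)
qed

text \<open>Well defined because members of \<open>mixed_ideal\<close> have coefficient 0 at every
  unmixed monomial.\<close>

lift_definition word_coeff :: "mseries \<Rightarrow> (nat \<times> nat) list \<Rightarrow> complex"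
  is "\<lambda>f ws. coeff f (mono_from 1 ws)"
proof (rule ext)
  fix f g ws assume "f - g \<in> mixed_ideal"
  hence "coeff (f - g) (mono_from 1 ws) = 0"
    unfolding mixed_ideal_def using mono_from_not_mixed by blast
  thus "coeff f (mono_from 1 ws) = coeff g (mono_from 1 ws)"
    by (simp add: minus_pseries_def)
qed

text \<open>An unmixed monomial comes from a weak colored composition, and quasi-symmetry reduces
  its coefficient to that of a positive word. The difference is therefore supported on mixed
  monomials.\<close>

lemma residue_class_eqI:
  assumes "f \<in> qsym_series l" "g \<in> qsym_series l"
    and eq: "\<And>w. positive_word l w \<Longrightarrow> coeff f (mono_from 1 w) = coeff g (mono_from 1 w)"
  shows "residue_class f = residue_class g"
proof -
  have fg: "f - g \<in> qsym_series l"
    using pseries.subspace_diff[OF qsym_series_subspace] assms by blast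
  have "\<exists>j p q. p \<noteq> q \<and> (j, p) \<in> Poly_Mapping.keys m \<and> (j, q) \<in> Poly_Mapping.keys m"
    if m: "coeff (f - g) m \<noteq> 0" for m
  proof (rule ccontr)
    assume "\<not> ?thesis"
    hence unmixed: "\<And>j p q. (j, p) \<in> Poly_Mapping.keys m \<Longrightarrow> (j, q) \<in> Poly_Mapping.keys m \<Longrightarrow> p = q"
      by blast
    have keys: "Poly_Mapping.keys m \<subseteq> {(j, c). 1 \<le> j \<and> c < l}"
      using fg m by (auto simp: qsym_series_def bounded_series_def)
    hence "Poly_Mapping.keys m \<subseteq> {(j, c). 1 \<le> j}" by auto
    then obtain ws where ws: "m = mono_from 1 ws"
      by (rule unmixed_monomial_eq_mono_from) (use unmixed in blast)+
    \<comment> \<open>Only the colors of nonzero parts are visible in the monomial, so the bound is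
      claimed only after stripping.\<close>
    have "snd x < l" if "x \<in> set (strip ws)" for x
    proof -
      from that obtain k where "k < length ws" "ws ! k = x" "fst x \<noteq> 0"
        by (auto simp: in_set_conv_nth)
      hence "(Suc k, snd x) \<in> Poly_Mapping.keys m"
        by (simp add: ws in_keys_iff lookup_mono_from)
      thus ?thesis using keys by auto
    qed
    hence "positive_word l (strip ws)"
      by (fastforce simp: positive_word_def)
    hence "coeff (f - g) (mono_from 1 (strip ws)) = 0"
      using eq by (simp add: minus_pseries_def)
    moreover have "coeff (f - g) (mono_from 1 ws) = coeff (f - g) (mono_from 1 (strip ws))"
      using fg unfolding qsym_series_def by blast
    ultimately show False using m ws by simp
  qed
  hence "f - g \<in> mixed_ideal" by (simp add: mixed_ideal_def)
  thus ?thesis by (simp add: mseries.abs_eq_iff)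
qed

section \<open>Finite expansions and the span\<close>

lemma finite_positive_words: "finite {w. positive_word l w \<and> degree_list w \<le> N}"
proof (rule finite_subset)
  show "{w. positive_word l w \<and> degree_list w \<le> N} \<subseteq>
      {w. set w \<subseteq> {..N} \<times> {..<l} \<and> length w \<le> N}"
  proof (safe, goal_cases)
    case (1 w a b)
    thus ?case using member_le_sum_list[of a "map fst w"] by (force simp: positive_word_def)
  next
    case (2 w a b)
    thus ?case by (auto simp: positive_word_def)
  next
    case (3 w)
    have "length w \<le> degree_list w" using 3(1)
      by (induction w) (auto simp: positive_word_def)
    thus ?case using 3(2) by simp
  qed
  show "finite {w. set w \<subseteq> {..N} \<times> {..<l} \<and> length w \<le> N}"
    by (rule finite_lists_length_le) auto
qed

lemma unzip_positive_word:
  assumes "positive_word l w"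
  shows "(map fst w, map snd w) \<in> colored_compositions l"
  using assms by (auto simp: positive_word_def colored_compositions_def)

text \<open>The series with prescribed coefficients \<open>\<alpha>\<close> at positive words. The
  cutoff \<open>N\<close> keeps the sum finite, so that its class lies in the linear span.\<close>

definition qsym_expansion :: "nat \<Rightarrow> nat \<Rightarrow> ((nat \<times> nat) list \<Rightarrow> complex) \<Rightarrow> pseries" where
  "qsym_expansion l N \<alpha> = (\<Sum>w | positive_word l w \<and> degree_list w \<le> N.
     scale_pseries (\<alpha> w) (M_qsym (map fst w, map snd w)))"

lemma qsym_expansion_in_qsym_series: "qsym_expansion l N \<alpha> \<in> qsym_series l"
  unfolding qsym_expansion_def
  by (intro pseries.subspace_sum pseries.subspace_scale qsym_series_subspace)
     (auto intro: M_qsym_in_qsym_series unzip_positive_word)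

lemma coeff_sum: "coeff (\<Sum>i\<in>A. F i) m = (\<Sum>i\<in>A. coeff (F i) m)"
  by (induction A rule: infinite_finite_induct) (simp_all add: zero_pseries_def plus_pseries_def)

lemma coeff_qsym_expansion:
  assumes "positive_word l w"
  shows "coeff (qsym_expansion l N \<alpha>) (mono_from (Suc 0) w) = (if degree_list w \<le> N then \<alpha> w else 0)"
proof -
  let ?W = "{w. positive_word l w \<and> degree_list w \<le> N}"
  have "coeff (qsym_expansion l N \<alpha>) (mono_from (Suc 0) w) = (\<Sum>v\<in>?W. if v = w then \<alpha> v else 0)"
    unfolding qsym_expansion_def coeff_sum
    by (rule sum.cong)
       (auto simp: scale_pseries_def coeff_M_qsym_mono_from[OF unzip_positive_word]
          strip_positive_word[OF assms] zip_map_fst_snd)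
  thus ?thesis using assms by (simp add: finite_positive_words)
qed

lemma residue_class_sum: "residue_class (\<Sum>i\<in>A. F i) = (\<Sum>i\<in>A. residue_class (F i))"
  by (induction A rule: infinite_finite_induct)
     (simp_all flip: zero_mseries.abs_eq plus_mseries.abs_eq)

lemma residue_qsym_expansion_in_M_span: "residue_class (qsym_expansion l N \<alpha>) \<in> M_span l"
  unfolding qsym_expansion_def residue_class_sum M_span_def scale_mseries.abs_eq[symmetric]
  by (intro mseries.span_sum mseries.span_scale mseries.span_base)
     (auto intro: unzip_positive_word)

lemma subspace_residue_qsym_series: "mseries.subspace (residue_class ` qsym_series l)"
proof (rule mseries.subspaceI)
  show "0 \<in> residue_class ` qsym_series l"
    using pseries.subspace_0[OF qsym_series_subspace] by (auto simp: zero_mseries.abs_eq)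
qed (use pseries.subspace_add[OF qsym_series_subspace] pseries.subspace_scale[OF qsym_series_subspace]
      in \<open>auto simp: plus_mseries.abs_eq scale_mseries.abs_eq\<close>)

text \<open>For the harder inclusion, a series of degree at most \<open>d\<close> has zero
  coefficients at words above \<open>d\<close>, so the expansion cut off at \<open>d\<close> has the
  same coefficients at all positive words and hence the same class.\<close>

lemma M_span_eq: "M_span l = residue_class ` qsym_series l"
proof
  show "M_span l \<subseteq> residue_class ` qsym_series l"
    unfolding M_span_def
    by (rule mseries.span_minimal[OF _ subspace_residue_qsym_series])
       (auto intro: M_qsym_in_qsym_series)
  show "residue_class ` qsym_series l \<subseteq> M_span l"
  proof safe
    fix f assume f: "f \<in> qsym_series l"
    then obtain d where d: "\<And>m. coeff f m \<noteq> 0 \<Longrightarrow> monomial_degree m \<le> d"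
      by (auto simp: qsym_series_def bounded_series_def)
    define g where "g = qsym_expansion l d (\<lambda>w. coeff f (mono_from 1 w))"
    have "residue_class f = residue_class g"
    proof (rule residue_class_eqI[OF f])
      show "g \<in> qsym_series l" by (simp add: g_def qsym_expansion_in_qsym_series)
      fix w assume w: "positive_word l w"
      show "coeff f (mono_from 1 w) = coeff g (mono_from 1 w)"
        using d[of "mono_from 1 w"]
        by (auto simp: g_def coeff_qsym_expansion[OF w] monomial_degree_mono_from)
    qed
    thus "residue_class f \<in> M_span l"
      by (simp add: g_def residue_qsym_expansion_in_M_span)
  qed
qed

lemma M_span_subalgebra: "is_subalgebra scale_mseries (M_span l) (residue_class ` bounded_series l)"
  unfolding is_subalgebra_def M_span_eq
proof (intro conjI ballI)
  show "residue_class ` qsym_series l \<subseteq> residue_class ` bounded_series l"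
    by (auto simp: qsym_series_def)
  show "1 \<in> residue_class ` qsym_series l"
    using qsym_series_one by (auto simp: one_mseries.abs_eq)
  show "f * g \<in> residue_class ` qsym_series l"
    if "f \<in> residue_class ` qsym_series l" "g \<in> residue_class ` qsym_series l" for f g
    using that qsym_series_mult by (auto simp: times_mseries.abs_eq)
qed (rule subspace_residue_qsym_series)

section \<open>The pairing\<close>

text \<open>The words form the basis of products of generators, so this is the linear extension of
  coefficient extraction. It is defined on all of \<open>mr\<close> and restricted to
  \<open>MR l\<close> where functionals are compared.\<close>

definition qsym_pairing :: "mseries \<Rightarrow> mr \<Rightarrow> complex" where
  "qsym_pairing f x = (\<Sum>w\<in>Poly_Mapping.keys x. Poly_Mapping.lookup x w * word_coeff f (letters w))"

lemma qsym_pairing_superset: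
  "finite A \<Longrightarrow> Poly_Mapping.keys x \<subseteq> A \<Longrightarrow>
    qsym_pairing f x = (\<Sum>w\<in>A. Poly_Mapping.lookup x w * word_coeff f (letters w))"
  unfolding qsym_pairing_def
  by (rule sum.mono_neutral_left) (auto simp: in_keys_iff)

lemma qsym_pairing_single: "qsym_pairing f (Poly_Mapping.single w c) = c * word_coeff f (letters w)"
  by (simp add: qsym_pairing_def)

lemma qsym_pairing_add_right: "qsym_pairing f (x + y) = qsym_pairing f x + qsym_pairing f y"
  using keys_add[of x y]
  by (simp add: qsym_pairing_superset[of "Poly_Mapping.keys x \<union> Poly_Mapping.keys y"]
      lookup_add distrib_right sum.distrib)

lemma lookup_map_times: "Poly_Mapping.lookup (Poly_Mapping.map ((*) c) x) w = c * Poly_Mapping.lookup x w"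
  for c :: complex
  by (simp add: Poly_Mapping.map.rep_eq when_def)

lemma lookup_scale_mr: "Poly_Mapping.lookup (scale_mr c x) w = c * Poly_Mapping.lookup x w"
  by (simp add: scale_mr_def lookup_map_times)

lemma keys_scale_mr: "Poly_Mapping.keys (scale_mr c x) \<subseteq> Poly_Mapping.keys x"
  by (auto simp: in_keys_iff lookup_scale_mr)

lemma qsym_pairing_scale_right: "qsym_pairing f (scale_mr c x) = c * qsym_pairing f x"
  by (subst qsym_pairing_superset[OF finite_keys keys_scale_mr])
     (simp add: lookup_scale_mr qsym_pairing_def sum_distrib_left mult.assoc)

lemma bilinear_qsym_pairing: "bilinear_pairing A B qsym_pairing"
proof -
  have "word_coeff (f + g) w = word_coeff f w + word_coeff g w" for f g w
    by transfer (simp add: plus_pseries_def)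
  moreover have "word_coeff (scale_mseries c f) w = c * word_coeff f w" for c f w
    by transfer (simp add: scale_pseries_def)
  ultimately show ?thesis
    unfolding bilinear_pairing_def
    by (auto simp: qsym_pairing_add_right qsym_pairing_scale_right)
       (simp_all add: qsym_pairing_def sum.distrib sum_distrib_left algebra_simps)
qed

section \<open>Functionals on the algebra and bijectivity\<close>

lemma single_in_MR_iff: "c \<noteq> 0 \<Longrightarrow> Poly_Mapping.single w c \<in> MR l \<longleftrightarrow> positive_word l (letters w)"
  by (simp add: MR_def positive_word_def)

lemma MR_add: "x \<in> MR l \<Longrightarrow> y \<in> MR l \<Longrightarrow> x + y \<in> MR l"
  using keys_add[of x y] unfolding MR_def by blast

lemma MR_scale: "x \<in> MR l \<Longrightarrow> scale_mr c x \<in> MR l"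
  using keys_scale_mr[of c x] unfolding MR_def by blast

lemma qsym_pairing_in_MR_functionals: "restrict (qsym_pairing f) (MR l) \<in> MR_functionals l"
  unfolding MR_functionals_def
  by (auto simp: MR_add MR_scale qsym_pairing_add_right qsym_pairing_scale_right)

lemma MR_functional_expansion:
  assumes \<phi>: "\<phi> \<in> MR_functionals l" and x: "x \<in> MR l"
  shows "\<phi> x = (\<Sum>w\<in>Poly_Mapping.keys x. Poly_Mapping.lookup x w * \<phi> (Poly_Mapping.single w 1))"
proof -
  have add: "\<phi> (y + z) = \<phi> y + \<phi> z" if "y \<in> MR l" "z \<in> MR l" for y z
    using \<phi> that by (auto simp: MR_functionals_def)
  have scale: "\<phi> (scale_mr c y) = c * \<phi> y" if "y \<in> MR l" for c y
    using \<phi> that by (auto simp: MR_functionals_def)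
  have zero_MR: "0 \<in> MR l" by (simp add: MR_def)
  have single: "Poly_Mapping.single w c = scale_mr c (Poly_Mapping.single w 1)" for w c
    by (rule poly_mapping_eqI) (simp add: lookup_scale_mr lookup_single when_def)
  have in_MR: "Poly_Mapping.single w c \<in> MR l" if "w \<in> Poly_Mapping.keys x" for w c
    using that x by (auto simp: MR_def)
  \<comment> \<open>Membership of the partial sums in \<open>MR l\<close> is carried along because
    \<open>\<phi>\<close> is additive only there.\<close>
  have sum: "(\<Sum>w\<in>A. Poly_Mapping.single w (Poly_Mapping.lookup x w)) \<in> MR l \<and>
      \<phi> (\<Sum>w\<in>A. Poly_Mapping.single w (Poly_Mapping.lookup x w)) =
        (\<Sum>w\<in>A. Poly_Mapping.lookup x w * \<phi> (Poly_Mapping.single w 1))"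
    if "finite A" "A \<subseteq> Poly_Mapping.keys x" for A
    using that
  proof (induction A rule: finite_induct)
    case empty
    show ?case using zero_MR scale[OF zero_MR, of 0] mr.scale_zero_left[of 0] by simp
  next
    case (insert w A)
    have "\<phi> (Poly_Mapping.single w (Poly_Mapping.lookup x w)) =
        Poly_Mapping.lookup x w * \<phi> (Poly_Mapping.single w 1)"
      using insert.prems by (subst single) (auto intro: scale in_MR)
    thus ?case using insert by (auto simp: add in_MR MR_add)
  qed
  have "x = (\<Sum>w\<in>Poly_Mapping.keys x. Poly_Mapping.single w (Poly_Mapping.lookup x w))"
    by (intro poly_mapping_eqI) (simp add: lookup_sum lookup_single when_def in_keys_iff)
  thus ?thesis using sum[OF finite_keys subset_refl] by metis
qed

lemma qsym_pairing_eq_0: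
  assumes "x \<in> MR_component l k"
    and "\<And>w. positive_word l w \<Longrightarrow> degree_list w = k \<Longrightarrow> word_coeff f w = 0"
  shows "qsym_pairing f x = 0"
  unfolding qsym_pairing_def
  by (rule sum.neutral)
     (use assms in \<open>auto simp: MR_component_def MR_def positive_word_def word_degree_def\<close>)

lemma single_in_MR_component:
  "positive_word l w \<Longrightarrow> Poly_Mapping.single (Word w) 1 \<in> MR_component l (degree_list w)"
  by (simp add: MR_component_def single_in_MR_iff word_degree_def)

text \<open>A degree bound for a representative series bounds the degrees of the words on which the
  functional can be nonzero.\<close>

lemma qsym_pairing_in_graded_dual:
  assumes "f \<in> M_span l"
  shows "restrict (qsym_pairing f) (MR l) \<in> graded_dual l"
proof -
  obtain g where g: "f = residue_class g" "g \<in> qsym_series l"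
    using assms by (auto simp: M_span_eq)
  then obtain d where d: "\<And>m. coeff g m \<noteq> 0 \<Longrightarrow> monomial_degree m \<le> d"
    by (auto simp: qsym_series_def bounded_series_def)
  have "restrict (qsym_pairing f) (MR l) x = 0" if "d < k" "x \<in> MR_component l k" for k x
  proof -
    have "word_coeff f w = 0" if "degree_list w = k" for w
      using d[of "mono_from 1 w"] that \<open>d < k\<close>
      by (auto simp: g word_coeff.abs_eq monomial_degree_mono_from)
    hence "qsym_pairing f x = 0" using qsym_pairing_eq_0 \<open>x \<in> MR_component l k\<close> by blast
    thus ?thesis using \<open>x \<in> MR_component l k\<close> by (simp add: MR_component_def)
  qed
  thus ?thesis using qsym_pairing_in_MR_functionals unfolding graded_dual_def by blast
qed

text \<open>Evaluation at single words recovers the coefficients at all positive words, which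
  determine a class in the span.\<close>

lemma qsym_pairing_inj:
  "inj_on (\<lambda>f. restrict (qsym_pairing f) (MR l)) (M_span l)"
proof (rule inj_onI)
  fix f g assume fg: "f \<in> M_span l" "g \<in> M_span l"
    and eq: "restrict (qsym_pairing f) (MR l) = restrict (qsym_pairing g) (MR l)"
  obtain f' g' where f': "f = residue_class f'" "f' \<in> qsym_series l"
    and g': "g = residue_class g'" "g' \<in> qsym_series l"
    using fg by (auto simp: M_span_eq)
  have "coeff f' (mono_from 1 w) = coeff g' (mono_from 1 w)" if "positive_word l w" for w
    using fun_cong[OF eq, of "Poly_Mapping.single (Word w) 1"] that
    by (simp add: single_in_MR_iff qsym_pairing_single f' g' word_coeff.abs_eq)
  thus "f = g" using residue_class_eqI[of f' l g'] f' g' by simp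
qed

text \<open>Surjectivity: the values of \<open>\<phi>\<close> on words serve as coefficients. Words
  above the cutoff \<open>N\<close> match because \<open>\<phi>\<close> vanishes there, and
  arguments outside \<open>MR l\<close> match by extensionality.\<close>

lemma qsym_pairing_expansion:
  assumes \<phi>: "\<phi> \<in> MR_functionals l" and N: "\<forall>k>N. \<forall>x\<in>MR_component l k. \<phi> x = 0"
  shows "restrict (qsym_pairing (residue_class
    (qsym_expansion l N (\<lambda>w. \<phi> (Poly_Mapping.single (Word w) 1))))) (MR l) = \<phi>"
    (is "restrict (qsym_pairing ?f) _ = _")
proof (rule ext)
  fix x
  show "restrict (qsym_pairing ?f) (MR l) x = \<phi> x"
  proof (cases "x \<in> MR l")
    case True
    have "word_coeff ?f (letters w) = \<phi> (Poly_Mapping.single w 1)" if "w \<in> Poly_Mapping.keys x" for w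
    proof -
      have w: "positive_word l (letters w)"
        using True that by (auto simp: MR_def positive_word_def)
      show ?thesis
        using N[rule_format, OF _ single_in_MR_component[OF w]]
        by (auto simp: word_coeff.abs_eq coeff_qsym_expansion[OF w])
    qed
    thus ?thesis using True
      by (simp add: MR_functional_expansion[OF \<phi>] qsym_pairing_def)
  next
    case False
    thus ?thesis using \<phi> by (auto simp: MR_functionals_def extensional_def)
  qed
qed

lemma qsym_pairing_bij:
  "bij_betw (\<lambda>f. restrict (qsym_pairing f) (MR l)) (M_span l) (graded_dual l)"
  unfolding bij_betw_def
proof (intro conjI qsym_pairing_inj equalityI subsetI)
  fix \<phi> assume "\<phi> \<in> graded_dual l"
  then obtain N where "\<phi> \<in> MR_functionals l" "\<forall>k>N. \<forall>x\<in>MR_component l k. \<phi> x = 0"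
    by (auto simp: graded_dual_def)
  from qsym_pairing_expansion[OF this] residue_qsym_expansion_in_M_span
  show "\<phi> \<in> (\<lambda>f. restrict (qsym_pairing f) (MR l)) ` M_span l"
    by (metis (no_types, lifting) image_eqI)
qed (use qsym_pairing_in_graded_dual in auto)

lemma qsym_pairing_dual_component:
  "(\<lambda>f. restrict (qsym_pairing f) (MR l)) ` (M_span l \<inter> residue_class ` homogeneous_series n) =
     dual_component l n"
proof (intro equalityI subsetI)
  fix \<phi> assume "\<phi> \<in> (\<lambda>f. restrict (qsym_pairing f) (MR l)) `
    (M_span l \<inter> residue_class ` homogeneous_series n)"
  then obtain h where h: "h \<in> homogeneous_series n"
    and \<phi>: "\<phi> = restrict (qsym_pairing (residue_class h)) (MR l)" by auto
  \<comment> \<open>Homogeneity of the representative \<open>h\<close> suffices: its coefficients at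
    words of degree \<open>k\<close> vanish.\<close>
  have "\<phi> x = 0" if "k \<noteq> n" "x \<in> MR_component l k" for k x
  proof -
    have "word_coeff (residue_class h) w = 0" if "degree_list w = k" for w
      using h that \<open>k \<noteq> n\<close>
      by (auto simp: word_coeff.abs_eq homogeneous_series_def monomial_degree_mono_from)
    hence "qsym_pairing (residue_class h) x = 0"
      using qsym_pairing_eq_0 \<open>x \<in> MR_component l k\<close> by blast
    thus ?thesis using \<open>x \<in> MR_component l k\<close> by (simp add: \<phi> MR_component_def)
  qed
  thus "\<phi> \<in> dual_component l n"
    using qsym_pairing_in_MR_functionals by (auto simp: dual_component_def \<phi>)
next
  fix \<phi> assume \<phi>: "\<phi> \<in> dual_component l n"
  define f where "f = qsym_expansion l n (\<lambda>w. \<phi> (Poly_Mapping.single (Word w) 1))"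
  have "restrict (qsym_pairing (residue_class f)) (MR l) = \<phi>"
    unfolding f_def by (rule qsym_pairing_expansion) (use \<phi> in \<open>auto simp: dual_component_def\<close>)
  moreover have "f \<in> homogeneous_series n"
    unfolding homogeneous_series_def
  proof (safe, rule ccontr)
    fix m assume m: "coeff f m \<noteq> 0" "monomial_degree m \<noteq> n"
    \<comment> \<open>The cutoff admits words of degree below \<open>n\<close>, but
      \<open>\<phi>\<close> kills those; words of degree \<open>n\<close> contribute only monomials
      of degree \<open>n\<close>.\<close>
    have "\<phi> (Poly_Mapping.single (Word w) 1) * coeff (M_qsym (map fst w, map snd w)) m = 0"
      if w: "positive_word l w" for w
    proof (cases "degree_list w = n")
      case True
      thus ?thesis
        using coeff_M_qsym_nonzero[OF unzip_positive_word[OF w], of m] m(2)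
        by (auto simp: zip_map_fst_snd)
    next
      case False
      thus ?thesis using \<phi> single_in_MR_component[OF w] by (auto simp: dual_component_def)
    qed
    hence "coeff f m = 0"
      unfolding f_def qsym_expansion_def coeff_sum
      by (intro sum.neutral) (auto simp: scale_pseries_def)
    with m(1) show False ..
  qed
  moreover have "residue_class f \<in> M_span l"
    unfolding f_def by (rule residue_qsym_expansion_in_M_span)
  ultimately show "\<phi> \<in> (\<lambda>f. restrict (qsym_pairing f) (MR l)) `
      (M_span l \<inter> residue_class ` homogeneous_series n)"
    by blast
qed

text \<open>Among positive words only the empty one gives the constant monomial.\<close>

lemma qsym_pairing_one: "restrict (qsym_pairing 1) (MR l) = dual_one l"
proof -
  have "qsym_pairing 1 x = counit x" if x: "x \<in> MR l" for x
  proof -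
    have "word_coeff 1 (letters w) = (if w = 0 then 1 else 0)" if "w \<in> Poly_Mapping.keys x" for w
    proof -
      have "strip (letters w) = letters w"
        using x that by (intro strip_positive_word[of l]) (auto simp: MR_def positive_word_def)
      thus ?thesis
        by (cases w) (simp add: one_mseries.abs_eq word_coeff.abs_eq one_pseries_def
            mono_from_eq_0_iff zero_word_def)
    qed
    hence "qsym_pairing 1 x = (\<Sum>w\<in>Poly_Mapping.keys x. if w = 0 then Poly_Mapping.lookup x w else 0)"
      unfolding qsym_pairing_def by (intro sum.cong) auto
    thus ?thesis by (simp add: counit_def in_keys_iff)
  qed
  thus ?thesis by (auto simp: dual_one_def)
qed

section \<open>The product as transpose of the coproduct\<close>

lemma tensor_functional_superset:
  "finite A \<Longrightarrow> Poly_Mapping.keys t \<subseteq> A \<Longrightarrow> tensor_functional \<phi> \<psi> t =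
    (\<Sum>(v, w)\<in>A. Poly_Mapping.lookup t (v, w) * (\<phi> (Poly_Mapping.single v 1) * \<psi> (Poly_Mapping.single w 1)))"
  unfolding tensor_functional_def
  by (rule sum.mono_neutral_left) (auto simp: in_keys_iff)

lemma tensor_functional_add:
  "tensor_functional \<phi> \<psi> (s + t) = tensor_functional \<phi> \<psi> s + tensor_functional \<phi> \<psi> t"
  using keys_add[of s t]
  by (simp add: tensor_functional_superset[of "Poly_Mapping.keys s \<union> Poly_Mapping.keys t"]
      lookup_add distrib_right sum.distrib case_prod_beta')

lemma tensor_functional_0: "tensor_functional \<phi> \<psi> 0 = 0"
  by (simp add: tensor_functional_def)

lemma tensor_functional_scale:
  "tensor_functional \<phi> \<psi> (Poly_Mapping.map ((*) c) t) = c * tensor_functional \<phi> \<psi> t"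
proof -
  have "Poly_Mapping.keys (Poly_Mapping.map ((*) c) t) \<subseteq> Poly_Mapping.keys t"
    by (auto simp: in_keys_iff lookup_map_times)
  from tensor_functional_superset[OF finite_keys this] show ?thesis
    by (simp add: tensor_functional_def lookup_map_times sum_distrib_left case_prod_beta' mult.assoc)
qed

lemma tensor_functional_single:
  "tensor_functional \<phi> \<psi> (Poly_Mapping.single (v, w) 1) =
     \<phi> (Poly_Mapping.single v 1) * \<psi> (Poly_Mapping.single w 1)"
  by (simp add: tensor_functional_def)

text \<open>Both sides are sums over the splittings of \<open>w\<close>. The coproduct deletes the
  zero parts of the halves, the product of series keeps them, and quasi-symmetry equates the
  two.\<close>

lemma tensor_functional_coproduct_word:
  assumes f: "f \<in> M_span l" and g: "g \<in> M_span l" and w: "positive_word l w"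
  shows "tensor_functional (restrict (qsym_pairing f) (MR l)) (restrict (qsym_pairing g) (MR l))
    (coproduct_word (Word w)) = word_coeff (f * g) w"
proof -
  obtain f' g' where f': "f = residue_class f'" "f' \<in> qsym_series l"
    and g': "g = residue_class g'" "g' \<in> qsym_series l"
    using f g by (auto simp: M_span_eq)
  \<comment> \<open>Since splittings keep the colors of \<open>w\<close>, the stripped halves lie in
    \<open>MR l\<close> and the restricted functionals take their true values on them.\<close>
  have eval: "restrict (qsym_pairing (residue_class h)) (MR l) (Poly_Mapping.single (Word (strip a)) 1) =
      coeff h (mono_from 1 a)"
    if "h \<in> qsym_series l" "map snd a = map snd w" for h a
  proof -
    have "snd ` set a = snd ` set w" using that(2) by (metis set_map)
    also have "\<dots> \<subseteq> {..<l}" using w by (auto simp: positive_word_def)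
    finally have "positive_word l (strip a)" by (force simp: positive_word_def)
    moreover have "coeff h (mono_from 1 (strip a)) = coeff h (mono_from 1 a)"
      using that(1) unfolding qsym_series_def by simp
    ultimately show ?thesis
      by (simp add: single_in_MR_iff qsym_pairing_single word_coeff.abs_eq)
  qed
  have "word_coeff (f * g) w =
      split_sum w (\<lambda>a b. coeff f' (mono_from 1 a) * coeff g' (mono_from 1 b))"
    by (simp add: f' g' times_mseries.abs_eq word_coeff.abs_eq coeff_mult_mono_from)
  also have "\<dots> = tensor_functional (restrict (qsym_pairing f) (MR l)) (restrict (qsym_pairing g) (MR l))
      (coproduct_word (Word w))"
    unfolding coproduct_word_eq_split_sum
      split_sum_hom[of "tensor_functional _ _", OF tensor_functional_0 tensor_functional_add]
      tensor_functional_single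
    by (rule split_sum_cong) (simp only: f' g' eval)
  finally show ?thesis by simp
qed

lemma qsym_pairing_mult:
  assumes "f \<in> M_span l" "g \<in> M_span l"
  shows "restrict (qsym_pairing (f * g)) (MR l) =
    dual_mult l (restrict (qsym_pairing f) (MR l)) (restrict (qsym_pairing g) (MR l))"
proof -
  let ?T = "tensor_functional (restrict (qsym_pairing f) (MR l)) (restrict (qsym_pairing g) (MR l))"
  have "?T (coproduct x) = qsym_pairing (f * g) x" if x: "x \<in> MR l" for x
  proof -
    have sum: "?T (\<Sum>w\<in>A. F w) = (\<Sum>w\<in>A. ?T (F w))" for A :: "mr_word set" and F
      by (induction A rule: infinite_finite_induct)
         (simp_all add: tensor_functional_0 tensor_functional_add)
    have "?T (coproduct_word w) = word_coeff (f * g) (letters w)" if "w \<in> Poly_Mapping.keys x" for w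
      using tensor_functional_coproduct_word[OF assms, of "letters w"] x that
      by (simp add: MR_def positive_word_def)
    thus ?thesis
      by (simp add: coproduct_def sum tensor_functional_scale qsym_pairing_def)
  qed
  thus ?thesis by (auto simp: dual_mult_def)
qed

section \<open>Kronecker symbols on the two bases\<close>

lemma S_prod_eq_single:
  assumes "(J, v) \<in> colored_compositions l"
  shows "S_prod (J, v) = Poly_Mapping.single (Word (zip J v)) 1"
proof -
  have "length J = length v" "\<forall>i\<in>set J. 1 \<le> i"
    using assms by (auto simp: colored_compositions_def)
  thus ?thesis
  proof (induction J v rule: list_induct2)
    case Nil
    show ?case by (simp add: S_prod_def flip: zero_word_def)
  next
    case (Cons i J c v)
    thus ?case by (simp add: S_prod_def S_gen_def mult_single plus_word_def)
  qed
qed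

text \<open>The pairing is the coefficient at the word \<open>zip J v\<close>, and zipping lists of
  equal length loses no information.\<close>

lemma qsym_pairing_M_S:
  assumes "(I, u) \<in> colored_compositions l" "(J, v) \<in> colored_compositions l"
  shows "qsym_pairing (residue_class (M_qsym (I, u))) (S_prod (J, v)) =
    kronecker I J * kronecker u v"
proof -
  have len: "length I = length u" "length J = length v"
    using assms by (auto simp: colored_compositions_def)
  have "strip (zip J v) = zip J v"
  proof (rule strip_positive_word)
    show "positive_word l (zip J v)"
      using assms(2) by (auto simp: positive_word_def colored_compositions_def
          dest: set_zip_leftD set_zip_rightD)
  qed
  moreover have "zip J v = zip I u \<longleftrightarrow> I = J \<and> u = v"
    using len by (metis map_fst_zip map_snd_zip)
  ultimately show ?thesis
    using coeff_M_qsym_mono_from[OF assms(1), of "zip J v"]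
    by (simp add: S_prod_eq_single[OF assms(2)] qsym_pairing_single word_coeff.abs_eq kronecker_def)
qed

theorem proposition6p3:
  fixes l :: nat
  shows "is_subalgebra scale_mseries (M_span l) (residue_class ` bounded_series l) \<and>
    (\<exists>pairing :: mseries \<Rightarrow> mr \<Rightarrow> complex.
       identifies_with_graded_dual l (M_span l) pairing \<and>
       (\<forall>(I, u) \<in> colored_compositions l. \<forall>(J, v) \<in> colored_compositions l.
          pairing (residue_class (M_qsym (I, u))) (S_prod (J, v)) = kronecker I J * kronecker u v))"
proof (intro conjI exI[where x = qsym_pairing])
  show "identifies_with_graded_dual l (M_span l) qsym_pairing"
    unfolding identifies_with_graded_dual_def Let_def
    using bilinear_qsym_pairing qsym_pairing_bij qsym_pairing_one qsym_pairing_mult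
      qsym_pairing_dual_component by blast
qed (use M_span_subalgebra qsym_pairing_M_S in auto)

end
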